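(* Let $A$ and $B$ be unital associative algebras over a field $k$. There is an algebra isomorphism $G:\mathsf{tw}\to A\otimes B^{op}$.
   Context: $\mathsf{tw}$ is the unital algebra, under composition, of $k$-linear endomorphisms $\psi': B\otimes A\to B\otimes A$ which are left $B$-linear and right $A$-linear for the actions $b'\cdot(b\otimes a)=b'b\otimes a$ and $(b\otimes a)\cdot a'=b\otimes aa'$. $B^{op}$ is the opposite algebra of $B$, and $A\otimes B^{op}$ is the usual tensor product algebra. *)

theory Defs
  imports "HOL-Algebra.Module" "HOL-Algebra.QuotRing"
begin

(* The locale algebra of HOL-Algebra requires a commutative multiplication, hence this variant.
   As for rings in HOL-Algebra, the zero algebra is allowed. *)
locale unital_algebra = module K A + field K + ring A for K (structure) and A (structure) +
  assumes smult_mult_left: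
      "\<lbrakk>c \<in> carrier K; x \<in> carrier A; y \<in> carrier A\<rbrakk>
        \<Longrightarrow> (c \<odot>\<^bsub>A\<^esub> x) \<otimes>\<^bsub>A\<^esub> y = c \<odot>\<^bsub>A\<^esub> (x \<otimes>\<^bsub>A\<^esub> y)"
    and smult_mult_right:
      "\<lbrakk>c \<in> carrier K; x \<in> carrier A; y \<in> carrier A\<rbrakk>
        \<Longrightarrow> x \<otimes>\<^bsub>A\<^esub> (c \<odot>\<^bsub>A\<^esub> y) = c \<odot>\<^bsub>A\<^esub> (x \<otimes>\<^bsub>A\<^esub> y)"

definition algebra_iso ::
  "('k, 'r) ring_scheme \<Rightarrow> ('k, 'a, 'm) module_scheme \<Rightarrow> ('k, 'b, 'n) module_scheme
    \<Rightarrow> ('a \<Rightarrow> 'b) set"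
  where "algebra_iso K A B =
    {h \<in> ring_iso A B. \<forall>c\<in>carrier K. \<forall>x\<in>carrier A. h (c \<odot>\<^bsub>A\<^esub> x) = c \<odot>\<^bsub>B\<^esub> h x}"

definition opposite :: "('k, 'a, 'm) module_scheme \<Rightarrow> ('k, 'a, 'm) module_scheme"
  where "opposite A = A\<lparr>mult := (\<lambda>x y. y \<otimes>\<^bsub>A\<^esub> x)\<rparr>"

(* The record type of modules extends that of rings; the fields mult and one of a module that
   is not an algebra are irrelevant and left undefined. *)

definition free_module :: "('k, 'r) ring_scheme \<Rightarrow> 'p set \<Rightarrow> ('k, 'p \<Rightarrow> 'k) module"
  where "free_module K S = \<lparr>
    carrier = {f. (\<forall>p. f p \<in> carrier K) \<and> (\<forall>p. p \<notin> S \<longrightarrow> f p = \<zero>\<^bsub>K\<^esub>) \<and> finite {p. f p \<noteq> \<zero>\<^bsub>K\<^esub>}},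
    mult = undefined, one = undefined,
    zero = (\<lambda>p. \<zero>\<^bsub>K\<^esub>),
    add = (\<lambda>f g p. f p \<oplus>\<^bsub>K\<^esub> g p),
    smult = (\<lambda>c f p. c \<otimes>\<^bsub>K\<^esub> f p)\<rparr>"

definition free_gen :: "('k, 'r) ring_scheme \<Rightarrow> 'p \<Rightarrow> 'p \<Rightarrow> 'k"
  where "free_gen K p = (\<lambda>q. if q = p then \<one>\<^bsub>K\<^esub> else \<zero>\<^bsub>K\<^esub>)"

definition submodule_span ::
  "('k, 'r) ring_scheme \<Rightarrow> ('k, 'v, 'm) module_scheme \<Rightarrow> 'v set \<Rightarrow> 'v set"
  where "submodule_span K M X = \<Inter>{H. submodule H K M \<and> X \<subseteq> H}"

definition quotient_module ::
  "('k, 'v, 'm) module_scheme \<Rightarrow> 'v set \<Rightarrow> ('k, 'v set) module"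
  where "quotient_module M N = \<lparr>
    carrier = a_rcosets\<^bsub>M\<^esub> N,
    mult = undefined, one = undefined,
    zero = N,
    add = (<+>\<^bsub>M\<^esub>),
    smult = (\<lambda>c X. \<Union>x\<in>X. N +>\<^bsub>M\<^esub> (c \<odot>\<^bsub>M\<^esub> x))\<rparr>"

definition tensor_relations ::
  "('k, 'r) ring_scheme \<Rightarrow> ('k, 'v, 'm) module_scheme \<Rightarrow> ('k, 'w, 'n) module_scheme
    \<Rightarrow> ('v \<times> 'w \<Rightarrow> 'k) set"
  where "tensor_relations K V W =
    (let F = free_module K (carrier V \<times> carrier W); e = (\<lambda>v w. free_gen K (v, w)) in
      {e (v \<oplus>\<^bsub>V\<^esub> v') w \<ominus>\<^bsub>F\<^esub> (e v w \<oplus>\<^bsub>F\<^esub> e v' w) | v v' w.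
          v \<in> carrier V \<and> v' \<in> carrier V \<and> w \<in> carrier W} \<union>
      {e v (w \<oplus>\<^bsub>W\<^esub> w') \<ominus>\<^bsub>F\<^esub> (e v w \<oplus>\<^bsub>F\<^esub> e v w') | v w w'.
          v \<in> carrier V \<and> w \<in> carrier W \<and> w' \<in> carrier W} \<union>
      {e (c \<odot>\<^bsub>V\<^esub> v) w \<ominus>\<^bsub>F\<^esub> (c \<odot>\<^bsub>F\<^esub> e v w) | c v w.
          c \<in> carrier K \<and> v \<in> carrier V \<and> w \<in> carrier W} \<union>
      {e v (c \<odot>\<^bsub>W\<^esub> w) \<ominus>\<^bsub>F\<^esub> (c \<odot>\<^bsub>F\<^esub> e v w) | c v w.
          c \<in> carrier K \<and> v \<in> carrier V \<and> w \<in> carrier W})"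

definition tensor_kernel ::
  "('k, 'r) ring_scheme \<Rightarrow> ('k, 'v, 'm) module_scheme \<Rightarrow> ('k, 'w, 'n) module_scheme
    \<Rightarrow> ('v \<times> 'w \<Rightarrow> 'k) set"
  where "tensor_kernel K V W =
    submodule_span K (free_module K (carrier V \<times> carrier W)) (tensor_relations K V W)"

definition tensor_module ::
  "('k, 'r) ring_scheme \<Rightarrow> ('k, 'v, 'm) module_scheme \<Rightarrow> ('k, 'w, 'n) module_scheme
    \<Rightarrow> ('k, ('v \<times> 'w \<Rightarrow> 'k) set) module"
  where "tensor_module K V W =
    quotient_module (free_module K (carrier V \<times> carrier W)) (tensor_kernel K V W)"

definition pure_tensor ::
  "('k, 'r) ring_scheme \<Rightarrow> ('k, 'v, 'm) module_scheme \<Rightarrow> ('k, 'w, 'n) module_scheme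
    \<Rightarrow> 'v \<Rightarrow> 'w \<Rightarrow> ('v \<times> 'w \<Rightarrow> 'k) set"
  where "pure_tensor K V W v w =
    tensor_kernel K V W +>\<^bsub>free_module K (carrier V \<times> carrier W)\<^esub> free_gen K (v, w)"

(* The linear map out of the tensor product of V and W into M that sends each pure tensor of
   v and w to phi v w. For bilinear phi the sum below takes the same value on all
   representatives f of the coset t, so the_elem is applied to a singleton. *)
definition tensor_lift ::
  "('k, 'r) ring_scheme \<Rightarrow> ('k, 'u, 'l) module_scheme
    \<Rightarrow> ('v \<Rightarrow> 'w \<Rightarrow> 'u) \<Rightarrow> ('v \<times> 'w \<Rightarrow> 'k) set \<Rightarrow> 'u"
  where "tensor_lift K M \<phi> t =
    the_elem ((\<lambda>f. \<Oplus>\<^bsub>M\<^esub>p\<in>{p. f p \<noteq> \<zero>\<^bsub>K\<^esub>}. f p \<odot>\<^bsub>M\<^esub> \<phi> (fst p) (snd p)) ` t)"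

definition tensor_algebra ::
  "('k, 'r) ring_scheme \<Rightarrow> ('k, 'a, 'm) module_scheme \<Rightarrow> ('k, 'b, 'n) module_scheme
    \<Rightarrow> ('k, ('a \<times> 'b \<Rightarrow> 'k) set) module"
  where "tensor_algebra K A B = (let T = tensor_module K A B in
    T\<lparr>mult := (\<lambda>s t. tensor_lift K T (\<lambda>a b. tensor_lift K T
                (\<lambda>a' b'. pure_tensor K A B (a \<otimes>\<^bsub>A\<^esub> a') (b \<otimes>\<^bsub>B\<^esub> b')) t) s),
      one := pure_tensor K A B \<one>\<^bsub>A\<^esub> \<one>\<^bsub>B\<^esub>\<rparr>)"

definition left_action ::
  "('k, 'r) ring_scheme \<Rightarrow> ('k, 'b, 'm) module_scheme \<Rightarrow> ('k, 'a, 'n) module_scheme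
    \<Rightarrow> 'b \<Rightarrow> ('b \<times> 'a \<Rightarrow> 'k) set \<Rightarrow> ('b \<times> 'a \<Rightarrow> 'k) set"
  where "left_action K B A b' =
    tensor_lift K (tensor_module K B A) (\<lambda>b a. pure_tensor K B A (b' \<otimes>\<^bsub>B\<^esub> b) a)"

definition right_action ::
  "('k, 'r) ring_scheme \<Rightarrow> ('k, 'b, 'm) module_scheme \<Rightarrow> ('k, 'a, 'n) module_scheme
    \<Rightarrow> ('b \<times> 'a \<Rightarrow> 'k) set \<Rightarrow> 'a \<Rightarrow> ('b \<times> 'a \<Rightarrow> 'k) set"
  where "right_action K B A t a' =
    tensor_lift K (tensor_module K B A) (\<lambda>b a. pure_tensor K B A b (a \<otimes>\<^bsub>A\<^esub> a')) t"

(* Maps are extensional (undefined outside the carrier), so that equality in End M is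
   equality of maps on carrier M. *)
definition End_algebra ::
  "('k, 'r) ring_scheme \<Rightarrow> ('k, 'v, 'm) module_scheme \<Rightarrow> ('k, 'v \<Rightarrow> 'v) module"
  where "End_algebra K M = \<lparr>
    carrier = {\<psi> \<in> carrier M \<rightarrow>\<^sub>E carrier M.
      (\<forall>x\<in>carrier M. \<forall>y\<in>carrier M. \<psi> (x \<oplus>\<^bsub>M\<^esub> y) = \<psi> x \<oplus>\<^bsub>M\<^esub> \<psi> y) \<and>
      (\<forall>c\<in>carrier K. \<forall>x\<in>carrier M. \<psi> (c \<odot>\<^bsub>M\<^esub> x) = c \<odot>\<^bsub>M\<^esub> \<psi> x)},
    mult = compose (carrier M),
    one = (\<lambda>x\<in>carrier M. x),
    zero = (\<lambda>x\<in>carrier M. \<zero>\<^bsub>M\<^esub>),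
    add = (\<lambda>\<psi> \<chi>. \<lambda>x\<in>carrier M. \<psi> x \<oplus>\<^bsub>M\<^esub> \<chi> x),
    smult = (\<lambda>c \<psi>. \<lambda>x\<in>carrier M. c \<odot>\<^bsub>M\<^esub> \<psi> x)\<rparr>"

definition tw ::
  "('k, 'r) ring_scheme \<Rightarrow> ('k, 'a, 'm) module_scheme \<Rightarrow> ('k, 'b, 'n) module_scheme
    \<Rightarrow> ('k, ('b \<times> 'a \<Rightarrow> 'k) set \<Rightarrow> ('b \<times> 'a \<Rightarrow> 'k) set) module"
  where "tw K A B = (let T = tensor_module K B A in
    (End_algebra K T)\<lparr>carrier := {\<psi> \<in> carrier (End_algebra K T).
      (\<forall>b\<in>carrier B. \<forall>t\<in>carrier T. \<psi> (left_action K B A b t) = left_action K B A b (\<psi> t)) \<and>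
      (\<forall>a\<in>carrier A. \<forall>t\<in>carrier T. \<psi> (right_action K B A t a) = right_action K B A (\<psi> t) a)}\<rparr>)"

end

theory Submission
  imports Defs
begin

text \<open>The left action of \<open>B\<close> and the right action of \<open>A\<close> on \<open>B \<otimes> A\<close> commute, so together they are
  a right action of \<open>C = A \<otimes> B\<^sup>o\<^sup>p\<close>. Exchanging the tensor factors identifies this right module
  with \<open>C\<close> acting on itself by right multiplication: \<open>b \<cdot> t \<cdot> a\<close> corresponds to the product of the
  exchanged \<open>t\<close> with \<open>a \<otimes> b\<close> (lemmas \<open>swap_lact\<close> and \<open>swap_ract\<close>). An element of \<open>tw\<close> is therefore
  an endomorphism of \<open>C\<close> as a right module over itself. Such an endomorphism is left multiplication
  by its value at the unit (\<open>swap_tw\<close>), and by associativity every left multiplication is one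
  (\<open>mult_twist_closed\<close>). Hence evaluation at \<open>1 \<otimes> 1\<close>, followed by the exchange of factors, is an
  isomorphism \<open>tw \<rightarrow> C\<close>; it preserves products because composition of left multiplications is the
  left multiplication by the product.

  What this argument uses about tensor products is that they are spanned by the pure tensors
  (\<open>tensor_induct\<close>) and that a bilinear map extends to a linear map (\<open>tensor_lift_universal\<close>). Both
  are read off from the presentation of the tensor product as a free module modulo the bilinearity
  relations. They give the algebra structure on the tensor product, the two actions, and the
  exchange of factors, and they reduce every identity between linear maps to pure tensors.\<close>

section \<open>Linear and bilinear maps\<close>

text \<open>In contrast to the elements of \<open>End_algebra\<close>, linear maps are not required to be extensional,
  so that composites, sums and lifts of linear maps are linear as they stand.\<close>

definition linear_map ::
  "('k, 'r) ring_scheme \<Rightarrow> ('k, 'v, 'm) module_scheme \<Rightarrow> ('k, 'w, 'n) module_scheme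
    \<Rightarrow> ('v \<Rightarrow> 'w) \<Rightarrow> bool"
  where "linear_map K M N h \<longleftrightarrow>
    (\<forall>x\<in>carrier M. h x \<in> carrier N) \<and>
    (\<forall>x\<in>carrier M. \<forall>y\<in>carrier M. h (x \<oplus>\<^bsub>M\<^esub> y) = h x \<oplus>\<^bsub>N\<^esub> h y) \<and>
    (\<forall>c\<in>carrier K. \<forall>x\<in>carrier M. h (c \<odot>\<^bsub>M\<^esub> x) = c \<odot>\<^bsub>N\<^esub> h x)"

definition bilinear_map ::
  "('k, 'r) ring_scheme \<Rightarrow> ('k, 'v, 'm) module_scheme \<Rightarrow> ('k, 'w, 'n) module_scheme
    \<Rightarrow> ('k, 'u, 'l) module_scheme \<Rightarrow> ('v \<Rightarrow> 'w \<Rightarrow> 'u) \<Rightarrow> bool"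
  where "bilinear_map K V W M \<phi> \<longleftrightarrow>
    (\<forall>v\<in>carrier V. linear_map K W M (\<phi> v)) \<and>
    (\<forall>w\<in>carrier W. linear_map K V M (\<lambda>v. \<phi> v w))"

lemma linear_mapI:
  assumes "\<And>x. x \<in> carrier M \<Longrightarrow> h x \<in> carrier N"
    and "\<And>x y. \<lbrakk>x \<in> carrier M; y \<in> carrier M\<rbrakk> \<Longrightarrow> h (x \<oplus>\<^bsub>M\<^esub> y) = h x \<oplus>\<^bsub>N\<^esub> h y"
    and "\<And>c x. \<lbrakk>c \<in> carrier K; x \<in> carrier M\<rbrakk> \<Longrightarrow> h (c \<odot>\<^bsub>M\<^esub> x) = c \<odot>\<^bsub>N\<^esub> h x"
  shows "linear_map K M N h"
  using assms by (auto simp: linear_map_def)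

lemma linear_map_closed: "\<lbrakk>linear_map K M N h; x \<in> carrier M\<rbrakk> \<Longrightarrow> h x \<in> carrier N"
  by (auto simp: linear_map_def)

lemma linear_map_add:
  "\<lbrakk>linear_map K M N h; x \<in> carrier M; y \<in> carrier M\<rbrakk> \<Longrightarrow> h (x \<oplus>\<^bsub>M\<^esub> y) = h x \<oplus>\<^bsub>N\<^esub> h y"
  by (auto simp: linear_map_def)

lemma linear_map_smult:
  "\<lbrakk>linear_map K M N h; c \<in> carrier K; x \<in> carrier M\<rbrakk>
    \<Longrightarrow> h (c \<odot>\<^bsub>M\<^esub> x) = c \<odot>\<^bsub>N\<^esub> h x"
  by (auto simp: linear_map_def)

lemma linear_map_comp:
  assumes "linear_map K M N g" "linear_map K N P h"
  shows "linear_map K M P (\<lambda>x. h (g x))"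
  using assms by (auto simp: linear_map_def)

lemma linear_map_cong:
  assumes "module K M" "linear_map K M N g" "\<And>x. x \<in> carrier M \<Longrightarrow> h x = g x"
  shows "linear_map K M N h"
proof -
  interpret M: module K M by fact
  show ?thesis using assms(2,3) by (simp add: linear_map_def)
qed

lemma linear_map_sum:
  assumes "module K N" "linear_map K M N g" "linear_map K M N h"
  shows "linear_map K M N (\<lambda>x. g x \<oplus>\<^bsub>N\<^esub> h x)"
proof -
  interpret N: module K N by fact
  note closed = linear_map_closed[OF assms(2)] linear_map_closed[OF assms(3)]
  show ?thesis
    by (rule linear_mapI)
      (simp_all add: closed linear_map_add[OF assms(2)] linear_map_add[OF assms(3)]
        linear_map_smult[OF assms(2)] linear_map_smult[OF assms(3)] N.smult_r_distr N.M.a_ac)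
qed

lemma linear_map_ident: "linear_map K M M (\<lambda>x. x)"
  by (simp add: linear_map_def)

lemma (in module) smult_linear: "c \<in> carrier R \<Longrightarrow> linear_map R M M (\<lambda>x. c \<odot>\<^bsub>M\<^esub> x)"
  by (rule linear_mapI) (simp_all add: smult_r_distr smult_assoc1[symmetric] R.m_comm)

lemma linear_map_zero:
  assumes "module K M" "module K N" "linear_map K M N h"
  shows "h \<zero>\<^bsub>M\<^esub> = \<zero>\<^bsub>N\<^esub>"
proof -
  interpret M: module K M by fact
  interpret N: module K N by fact
  have "h (\<zero>\<^bsub>K\<^esub> \<odot>\<^bsub>M\<^esub> \<zero>\<^bsub>M\<^esub>) = \<zero>\<^bsub>K\<^esub> \<odot>\<^bsub>N\<^esub> h \<zero>\<^bsub>M\<^esub>"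
    using assms(3) by (rule linear_map_smult) simp_all
  then show ?thesis using linear_map_closed[OF assms(3)] by simp
qed

lemma linear_map_minus:
  assumes "module K M" "module K N" "linear_map K M N h" "x \<in> carrier M"
  shows "h (\<ominus>\<^bsub>M\<^esub> x) = \<ominus>\<^bsub>N\<^esub> h x"
proof -
  interpret M: module K M by fact
  interpret N: module K N by fact
  have "h (\<ominus>\<^bsub>M\<^esub> x) \<oplus>\<^bsub>N\<^esub> h x = h (\<ominus>\<^bsub>M\<^esub> x \<oplus>\<^bsub>M\<^esub> x)"
    using assms by (simp add: linear_map_add)
  also have "\<dots> = \<zero>\<^bsub>N\<^esub>" using assms linear_map_zero[OF assms(1-3)] by (simp add: M.M.l_neg)
  finally show ?thesis
    using assms linear_map_closed[OF assms(3)] by (simp add: N.M.minus_equality)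
qed

lemma linear_map_diff:
  assumes "module K M" "module K N" "linear_map K M N h" "x \<in> carrier M" "y \<in> carrier M"
  shows "h (x \<ominus>\<^bsub>M\<^esub> y) = h x \<ominus>\<^bsub>N\<^esub> h y"
proof -
  interpret M: module K M by fact
  show ?thesis
    using assms(4,5) linear_map_minus[OF assms(1-3)] linear_map_add[OF assms(3)]
    by (simp add: a_minus_def)
qed

lemma kernel_is_submodule:
  assumes "module K M" "module K N" "linear_map K M N h"
  shows "submodule {x \<in> carrier M. h x = \<zero>\<^bsub>N\<^esub>} K M"
proof -
  interpret M: module K M by fact
  interpret N: module K N by fact
  show ?thesis
    using linear_map_zero[OF assms] linear_map_minus[OF assms] linear_map_add[OF assms(3)]
      linear_map_smult[OF assms(3)]
    by (intro M.submoduleI) auto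
qed

lemma bilinear_mapI:
  assumes "\<And>v w. \<lbrakk>v \<in> carrier V; w \<in> carrier W\<rbrakk> \<Longrightarrow> \<phi> v w \<in> carrier M"
    and "\<And>v v' w. \<lbrakk>v \<in> carrier V; v' \<in> carrier V; w \<in> carrier W\<rbrakk>
      \<Longrightarrow> \<phi> (v \<oplus>\<^bsub>V\<^esub> v') w = \<phi> v w \<oplus>\<^bsub>M\<^esub> \<phi> v' w"
    and "\<And>v w w'. \<lbrakk>v \<in> carrier V; w \<in> carrier W; w' \<in> carrier W\<rbrakk>
      \<Longrightarrow> \<phi> v (w \<oplus>\<^bsub>W\<^esub> w') = \<phi> v w \<oplus>\<^bsub>M\<^esub> \<phi> v w'"
    and "\<And>c v w. \<lbrakk>c \<in> carrier K; v \<in> carrier V; w \<in> carrier W\<rbrakk>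
      \<Longrightarrow> \<phi> (c \<odot>\<^bsub>V\<^esub> v) w = c \<odot>\<^bsub>M\<^esub> \<phi> v w"
    and "\<And>c v w. \<lbrakk>c \<in> carrier K; v \<in> carrier V; w \<in> carrier W\<rbrakk>
      \<Longrightarrow> \<phi> v (c \<odot>\<^bsub>W\<^esub> w) = c \<odot>\<^bsub>M\<^esub> \<phi> v w"
  shows "bilinear_map K V W M \<phi>"
  using assms by (auto simp: bilinear_map_def linear_map_def)

lemma bilinear_mapD:
  assumes "bilinear_map K V W M \<phi>"
  shows "\<And>v. v \<in> carrier V \<Longrightarrow> linear_map K W M (\<phi> v)"
    and "\<And>w. w \<in> carrier W \<Longrightarrow> linear_map K V M (\<lambda>v. \<phi> v w)"
  using assms by (auto simp: bilinear_map_def)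


lemma bilinear_map_flip:
  "bilinear_map K V W M \<phi> \<Longrightarrow> bilinear_map K W V M (\<lambda>w v. \<phi> v w)"
  by (simp add: bilinear_map_def)

lemma bilinear_map_comp:
  assumes "bilinear_map K V W M \<phi>" "linear_map K V' V f" "linear_map K W' W g"
  shows "bilinear_map K V' W' M (\<lambda>v w. \<phi> (f v) (g w))"
  unfolding bilinear_map_def
  using linear_map_comp[OF assms(2) bilinear_mapD(2)[OF assms(1) linear_map_closed[OF assms(3)]]]
    linear_map_comp[OF assms(3) bilinear_mapD(1)[OF assms(1) linear_map_closed[OF assms(2)]]]
  by simp

text \<open>The opposite algebra and the tensor algebra change only the ring multiplication and unit of a
  given module; this carries the module laws over to them.\<close>

lemma module_cong:
  assumes "module K M" and same: "carrier M' = carrier M" "\<zero>\<^bsub>M'\<^esub> = \<zero>\<^bsub>M\<^esub>"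
    "(\<oplus>\<^bsub>M'\<^esub>) = (\<oplus>\<^bsub>M\<^esub>)" "(\<odot>\<^bsub>M'\<^esub>) = (\<odot>\<^bsub>M\<^esub>)"
  shows "module K M'"
proof -
  interpret M: module K M by fact
  have "abelian_group M'"
  proof (rule abelian_groupI)
    fix x assume "x \<in> carrier M'"
    then show "\<exists>y\<in>carrier M'. y \<oplus>\<^bsub>M'\<^esub> x = \<zero>\<^bsub>M'\<^esub>"
      by (intro bexI[of _ "\<ominus>\<^bsub>M\<^esub> x"]) (simp_all add: same M.M.l_neg)
  qed (simp_all add: same M.M.a_ac)
  then show ?thesis
    by (intro moduleI[OF M.R.is_cring])
      (simp_all add: same M.smult_l_distr M.smult_r_distr M.smult_assoc1)
qed


section \<open>Free modules\<close>

lemma (in cring) free_module_is_module: "module R (free_module R S)"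
proof -
  let ?F = "free_module R S"
  have fin: "finite {p. h p \<noteq> \<zero>}"
    if "\<And>p. f p = \<zero> \<Longrightarrow> g p = \<zero> \<Longrightarrow> h p = \<zero>" "finite {p. f p \<noteq> \<zero>}" "finite {p. g p \<noteq> \<zero>}"
    for f g h :: "'p \<Rightarrow> 'a"
    using that by (auto intro: finite_subset[of _ "{p. f p \<noteq> \<zero>} \<union> {p. g p \<noteq> \<zero>}"])
  have ab: "abelian_group ?F"
  proof (rule abelian_groupI)
    fix f g assume "f \<in> carrier ?F" "g \<in> carrier ?F"
    then show "f \<oplus>\<^bsub>?F\<^esub> g \<in> carrier ?F"
      using fin[of f g "\<lambda>p. f p \<oplus> g p"] by (auto simp: free_module_def)
  next
    fix f assume f: "f \<in> carrier ?F"
    have "(\<lambda>p. \<ominus> f p) \<in> carrier ?F"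
      using f fin[of f f "\<lambda>p. \<ominus> f p"] by (auto simp: free_module_def)
    moreover have "(\<lambda>p. \<ominus> f p) \<oplus>\<^bsub>?F\<^esub> f = \<zero>\<^bsub>?F\<^esub>"
      using f by (auto simp: free_module_def l_neg)
    ultimately show "\<exists>g\<in>carrier ?F. g \<oplus>\<^bsub>?F\<^esub> f = \<zero>\<^bsub>?F\<^esub>" by blast
  qed (auto simp: free_module_def a_ac)
  show ?thesis
  proof (rule moduleI[OF is_cring ab])
    fix c f assume "c \<in> carrier R" "f \<in> carrier ?F"
    then show "c \<odot>\<^bsub>?F\<^esub> f \<in> carrier ?F"
      using fin[of f f "\<lambda>p. c \<otimes> f p"] by (auto simp: free_module_def)
  qed (auto simp: free_module_def l_distr r_distr m_assoc)
qed

lemma (in cring) free_gen_closed: "p \<in> S \<Longrightarrow> free_gen R p \<in> carrier (free_module R S)"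
  by (auto simp: free_gen_def free_module_def)

text \<open>Removing one point from the support of \<open>f\<close> splits off a multiple of a generator, so induction
  on a finite set containing the support works.\<close>

lemma (in cring) free_module_induct [consumes 1, case_names zero gen add]:
  assumes "f \<in> carrier (free_module R S)"
    and zero: "P \<zero>\<^bsub>free_module R S\<^esub>"
    and gen: "\<And>c p. \<lbrakk>c \<in> carrier R; p \<in> S\<rbrakk> \<Longrightarrow> P (c \<odot>\<^bsub>free_module R S\<^esub> free_gen R p)"
    and add: "\<And>f g. \<lbrakk>f \<in> carrier (free_module R S); g \<in> carrier (free_module R S); P f; P g\<rbrakk>
      \<Longrightarrow> P (f \<oplus>\<^bsub>free_module R S\<^esub> g)"
  shows "P f"
proof -
  let ?F = "free_module R S"
  interpret F: module R ?F by (rule free_module_is_module)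
  have "P f" if "finite D" "f \<in> carrier ?F" "{p. f p \<noteq> \<zero>} \<subseteq> D" for D f
    using that
  proof (induction D arbitrary: f)
    case empty
    then have "f = \<zero>\<^bsub>?F\<^esub>" by (auto simp: free_module_def)
    then show ?case using zero by simp
  next
    case (insert p D)
    show ?case
    proof (cases "f p = \<zero>")
      case True
      then show ?thesis using insert by (intro insert.IH) auto
    next
      case False
      let ?g = "f(p := \<zero>)" and ?h = "f p \<odot>\<^bsub>?F\<^esub> free_gen R p"
      have p: "p \<in> S" "f p \<in> carrier R" using False insert.prems by (auto simp: free_module_def)
      have g: "?g \<in> carrier ?F"
        using insert.prems
        by (auto simp: free_module_def intro: finite_subset[of _ "{p. f p \<noteq> \<zero>}"])
      have h: "?h \<in> carrier ?F" using p by (simp add: free_gen_closed)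
      have "f = ?g \<oplus>\<^bsub>?F\<^esub> ?h"
        using insert.prems by (auto simp: free_module_def free_gen_def)
      moreover have "P ?g" using insert.prems by (intro insert.IH[OF g]) auto
      ultimately show ?thesis using add[OF g h] gen[OF p(2,1)] by metis
    qed
  qed
  from this[OF _ assms(1) order_refl] show ?thesis
    using assms(1) by (simp add: free_module_def)
qed

text \<open>The universal property of the free module. A sum over the support of \<open>f\<close> may be taken over
  any larger finite set, so that two supports can be enlarged to a common one when sums are
  compared.\<close>

lemma (in module) free_extension_linear:
  assumes g: "\<And>p. p \<in> S \<Longrightarrow> g p \<in> carrier M"
  shows "linear_map R (free_module R S) M (\<lambda>f. \<Oplus>\<^bsub>M\<^esub>p\<in>{p. f p \<noteq> \<zero>}. f p \<odot>\<^bsub>M\<^esub> g p)"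
    and "p \<in> S \<Longrightarrow> (\<Oplus>\<^bsub>M\<^esub>q\<in>{q. free_gen R p q \<noteq> \<zero>}. free_gen R p q \<odot>\<^bsub>M\<^esub> g q) = g p"
proof -
  let ?F = "free_module R S"
  let ?L = "\<lambda>f. \<Oplus>\<^bsub>M\<^esub>p\<in>{p. f p \<noteq> \<zero>}. f p \<odot>\<^bsub>M\<^esub> g p"
  interpret F: module R ?F by (rule free_module_is_module)
  have L: "?L f = (\<Oplus>\<^bsub>M\<^esub>p\<in>D. f p \<odot>\<^bsub>M\<^esub> g p)"
    if "f \<in> carrier ?F" "finite D" "D \<subseteq> S" "{p. f p \<noteq> \<zero>} \<subseteq> D" for f D
    using that g
    by (intro M.add.finprod_mono_neutral_cong_left) (auto simp: free_module_def Pi_def)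
  have supp: "finite {p. f p \<noteq> \<zero>}" "{p. f p \<noteq> \<zero>} \<subseteq> S" "\<And>p. f p \<in> carrier R"
    if "f \<in> carrier ?F" for f
    using that by (auto simp: free_module_def)
  show "linear_map R ?F M ?L"
  proof (rule linear_mapI)
    fix f assume f: "f \<in> carrier ?F"
    show "?L f \<in> carrier M" using supp[OF f] g by (intro M.finsum_closed) auto
    fix c assume c: "c \<in> carrier R"
    have "?L (c \<odot>\<^bsub>?F\<^esub> f) = (\<Oplus>\<^bsub>M\<^esub>p\<in>{p. f p \<noteq> \<zero>}. (c \<odot>\<^bsub>?F\<^esub> f) p \<odot>\<^bsub>M\<^esub> g p)"
      using supp[OF f] f c by (intro L F.smult_closed) (auto simp: free_module_def)
    also have "\<dots> = (\<Oplus>\<^bsub>M\<^esub>p\<in>{p. f p \<noteq> \<zero>}. c \<odot>\<^bsub>M\<^esub> (f p \<odot>\<^bsub>M\<^esub> g p))"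
      using supp[OF f] g c
      by (intro M.finsum_cong') (auto simp: free_module_def smult_assoc1)
    also have "\<dots> = c \<odot>\<^bsub>M\<^esub> ?L f"
      using supp[OF f] g c by (intro finsum_smult_ldistr[symmetric]) auto
    finally show "?L (c \<odot>\<^bsub>?F\<^esub> f) = c \<odot>\<^bsub>M\<^esub> ?L f" .
  next
    fix f h assume f: "f \<in> carrier ?F" and h: "h \<in> carrier ?F"
    let ?D = "{p. f p \<noteq> \<zero>} \<union> {p. h p \<noteq> \<zero>}"
    have D: "finite ?D" "?D \<subseteq> S" using supp[OF f] supp[OF h] by auto
    have "?L (f \<oplus>\<^bsub>?F\<^esub> h) = (\<Oplus>\<^bsub>M\<^esub>p\<in>?D. (f \<oplus>\<^bsub>?F\<^esub> h) p \<odot>\<^bsub>M\<^esub> g p)"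
      using D f h by (intro L F.M.a_closed) (auto simp: free_module_def)
    also have "\<dots> = (\<Oplus>\<^bsub>M\<^esub>p\<in>?D. f p \<odot>\<^bsub>M\<^esub> g p \<oplus>\<^bsub>M\<^esub> h p \<odot>\<^bsub>M\<^esub> g p)"
      using supp[OF f] supp[OF h] g
      by (intro M.finsum_cong') (auto simp: free_module_def smult_l_distr)
    also have "\<dots> = (\<Oplus>\<^bsub>M\<^esub>p\<in>?D. f p \<odot>\<^bsub>M\<^esub> g p) \<oplus>\<^bsub>M\<^esub> (\<Oplus>\<^bsub>M\<^esub>p\<in>?D. h p \<odot>\<^bsub>M\<^esub> g p)"
      using supp[OF f] supp[OF h] g by (intro M.finsum_addf) auto
    also have "\<dots> = ?L f \<oplus>\<^bsub>M\<^esub> ?L h"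
      using D L[OF f, of ?D] L[OF h, of ?D] by simp
    finally show "?L (f \<oplus>\<^bsub>?F\<^esub> h) = ?L f \<oplus>\<^bsub>M\<^esub> ?L h" .
  qed
  assume p: "p \<in> S"
  have "?L (free_gen R p) = (\<Oplus>\<^bsub>M\<^esub>q\<in>{p}. free_gen R p q \<odot>\<^bsub>M\<^esub> g q)"
    using p by (intro L) (auto simp: free_gen_closed, auto simp: free_gen_def split: if_splits)
  also have "\<dots> = g p" using g[OF p] by (simp add: free_gen_def)
  finally show "?L (free_gen R p) = g p" .
qed


section \<open>Quotient modules\<close>

lemma (in module) submodule_span_is_submodule:
  assumes "X \<subseteq> carrier M"
  shows "submodule (submodule_span R M X) R M"
proof -
  have "carrier M \<in> {H. submodule H R M \<and> X \<subseteq> H}"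
    using assms carrier_is_submodule by simp
  moreover have "\<zero>\<^bsub>M\<^esub> \<in> H" if "submodule H R M" for H
    using subgroup.one_closed[OF submodule.axioms(1)[OF that]] by simp
  ultimately show ?thesis
    unfolding submodule_span_def by (intro submoduleI) (blast intro: submoduleE)+
qed

lemma submodule_span_least: "\<lbrakk>submodule H K M; X \<subseteq> H\<rbrakk> \<Longrightarrow> submodule_span K M X \<subseteq> H"
  by (auto simp: submodule_span_def)

lemma submodule_span_superset: "X \<subseteq> submodule_span K M X"
  by (auto simp: submodule_span_def)

locale quotient = module +
  fixes N
  assumes submodule: "submodule N R M"
begin

sublocale N: abelian_subgroup N M
  using submodule
  by (intro abelian_subgroupI3 additive_subgroupI) (auto simp: submodule_def M.abelian_group_axioms)

abbreviation "Q \<equiv> quotient_module M N"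

lemma quotient_carrier: "carrier Q = (\<lambda>x. N +>\<^bsub>M\<^esub> x) ` carrier M"
  unfolding quotient_module_def A_RCOSETS_def RCOSETS_def a_r_coset_def by auto

lemma coset_closed: "x \<in> carrier M \<Longrightarrow> N +>\<^bsub>M\<^esub> x \<in> carrier Q"
  by (simp add: quotient_carrier)

lemma coset_add:
  "\<lbrakk>x \<in> carrier M; y \<in> carrier M\<rbrakk>
    \<Longrightarrow> (N +>\<^bsub>M\<^esub> x) \<oplus>\<^bsub>Q\<^esub> (N +>\<^bsub>M\<^esub> y) = N +>\<^bsub>M\<^esub> (x \<oplus>\<^bsub>M\<^esub> y)"
  by (simp add: quotient_module_def N.a_rcos_sum)

lemma coset_eqI:
  assumes "x \<in> carrier M" "y \<in> carrier M" "x \<ominus>\<^bsub>M\<^esub> y \<in> N"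
  shows "N +>\<^bsub>M\<^esub> x = N +>\<^bsub>M\<^esub> y"
proof -
  have "x \<in> N +>\<^bsub>M\<^esub> y"
    using assms N.a_rcos_module[of y x] by (simp add: a_minus_def)
  then show ?thesis using assms(1,2) by (intro N.a_repr_independence'[symmetric])
qed

lemma coset_memE:
  assumes "x \<in> carrier M" "y \<in> N +>\<^bsub>M\<^esub> x"
  obtains n where "n \<in> N" "y = n \<oplus>\<^bsub>M\<^esub> x"
  using assms by (auto simp: a_r_coset_def')

lemma coset_smult:
  assumes "c \<in> carrier R" "x \<in> carrier M"
  shows "c \<odot>\<^bsub>Q\<^esub> (N +>\<^bsub>M\<^esub> x) = N +>\<^bsub>M\<^esub> (c \<odot>\<^bsub>M\<^esub> x)"
proof -
  have "N +>\<^bsub>M\<^esub> (c \<odot>\<^bsub>M\<^esub> y) = N +>\<^bsub>M\<^esub> (c \<odot>\<^bsub>M\<^esub> x)" if "y \<in> N +>\<^bsub>M\<^esub> x" for y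
  proof -
    obtain n where n: "n \<in> N" "y = n \<oplus>\<^bsub>M\<^esub> x" using assms(2) \<open>y \<in> N +>\<^bsub>M\<^esub> x\<close> by (rule coset_memE)
    have "c \<odot>\<^bsub>M\<^esub> n \<in> N" using submodule n(1) assms(1) by (simp add: submodule.smult_closed)
    then have "c \<odot>\<^bsub>M\<^esub> y \<in> N +>\<^bsub>M\<^esub> (c \<odot>\<^bsub>M\<^esub> x)"
      using n assms by (auto simp: smult_r_distr a_r_coset_def')
    then show ?thesis using assms n by (intro N.a_repr_independence'[symmetric]) auto
  qed
  moreover have "x \<in> N +>\<^bsub>M\<^esub> x" using assms(2) by (rule N.a_rcos_self)
  ultimately have "(\<Union>y\<in>N +>\<^bsub>M\<^esub> x. N +>\<^bsub>M\<^esub> (c \<odot>\<^bsub>M\<^esub> y)) = N +>\<^bsub>M\<^esub> (c \<odot>\<^bsub>M\<^esub> x)" by blast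
  then show ?thesis by (simp add: quotient_module_def)
qed

lemma quotient_is_module: "module R Q"
proof -
  have zero: "\<zero>\<^bsub>Q\<^esub> = N +>\<^bsub>M\<^esub> \<zero>\<^bsub>M\<^esub>"
    using M.a_coset_add_zero[OF N.a_subset] by (simp add: quotient_module_def)
  have "abelian_group Q"
  proof (rule abelian_groupI)
    fix t assume "t \<in> carrier Q"
    then obtain x where "x \<in> carrier M" "t = N +>\<^bsub>M\<^esub> x" by (auto simp: quotient_carrier)
    then show "\<exists>s\<in>carrier Q. s \<oplus>\<^bsub>Q\<^esub> t = \<zero>\<^bsub>Q\<^esub>"
      by (intro bexI[of _ "N +>\<^bsub>M\<^esub> (\<ominus>\<^bsub>M\<^esub> x)"]) (auto simp: zero coset_add coset_closed M.l_neg)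
  qed (auto simp: quotient_carrier zero coset_add M.a_ac)
  then show ?thesis
    by (intro moduleI[OF R.is_cring])
      (auto simp: quotient_carrier coset_add coset_smult smult_l_distr smult_r_distr smult_assoc1)
qed

lemma coset_linear: "linear_map R M Q (\<lambda>x. N +>\<^bsub>M\<^esub> x)"
  by (rule linear_mapI) (simp_all add: coset_closed coset_add coset_smult)

text \<open>A linear map that vanishes on \<open>N\<close> is constant on each coset, hence factors through the
  quotient.\<close>

lemma factor_map:
  assumes P: "module R P" and h: "linear_map R M P h" and vanish: "\<And>n. n \<in> N \<Longrightarrow> h n = \<zero>\<^bsub>P\<^esub>"
  shows "\<And>x. x \<in> carrier M \<Longrightarrow> the_elem (h ` (N +>\<^bsub>M\<^esub> x)) = h x"
    and "linear_map R Q P (\<lambda>t. the_elem (h ` t))"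
proof -
  interpret P: module R P by fact
  show el: "the_elem (h ` (N +>\<^bsub>M\<^esub> x)) = h x" if x: "x \<in> carrier M" for x
  proof -
    have const: "h y = h x" if "y \<in> N +>\<^bsub>M\<^esub> x" for y
    proof -
      obtain n where "n \<in> N" "y = n \<oplus>\<^bsub>M\<^esub> x" using x \<open>y \<in> N +>\<^bsub>M\<^esub> x\<close> by (rule coset_memE)
      then show ?thesis
        using x vanish linear_map_closed[OF h] by (simp add: linear_map_add[OF h])
    qed
    have "x \<in> N +>\<^bsub>M\<^esub> x" using x by (rule N.a_rcos_self)
    then have "h ` (N +>\<^bsub>M\<^esub> x) = {h x}" using const by blast
    then show ?thesis by simp
  qed
  show "linear_map R Q P (\<lambda>t. the_elem (h ` t))"
  proof (rule linear_mapI)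
    fix t assume "t \<in> carrier Q"
    then obtain x where x: "x \<in> carrier M" "t = N +>\<^bsub>M\<^esub> x" by (auto simp: quotient_carrier)
    then show "the_elem (h ` t) \<in> carrier P" by (simp add: el linear_map_closed[OF h])
    fix c assume "c \<in> carrier R"
    with x show "the_elem (h ` (c \<odot>\<^bsub>Q\<^esub> t)) = c \<odot>\<^bsub>P\<^esub> the_elem (h ` t)"
      by (simp add: coset_smult el linear_map_smult[OF h])
  next
    fix s t assume "s \<in> carrier Q" "t \<in> carrier Q"
    then obtain x y where "x \<in> carrier M" "s = N +>\<^bsub>M\<^esub> x" "y \<in> carrier M" "t = N +>\<^bsub>M\<^esub> y"
      by (auto simp: quotient_carrier)
    then show "the_elem (h ` (s \<oplus>\<^bsub>Q\<^esub> t)) = the_elem (h ` s) \<oplus>\<^bsub>P\<^esub> the_elem (h ` t)"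
      by (simp add: coset_add el linear_map_add[OF h])
  qed
qed

end


section \<open>Tensor products of modules\<close>

lemma Collect3_subset_iff:
  "{f x y z | x y z. x \<in> A \<and> y \<in> B \<and> z \<in> C} \<subseteq> X
    \<longleftrightarrow> (\<forall>x\<in>A. \<forall>y\<in>B. \<forall>z\<in>C. f x y z \<in> X)"
  by blast

text \<open>A direct reading of the four families of relations as membership conditions. It serves to
  see that the relations lie in the free module, that pure tensors are bilinear, and that the linear
  extension of a bilinear map annihilates the relations.\<close>

lemma tensor_relations_subset_iff:
  fixes K :: "('k, 'r) ring_scheme"
    and V :: "('k, 'v, 'm) module_scheme" and W :: "('k, 'w, 'n) module_scheme"
  defines "F \<equiv> free_module K (carrier V \<times> carrier W)"
    and "e \<equiv> \<lambda>v w. free_gen K (v, w)"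
  shows "tensor_relations K V W \<subseteq> X \<longleftrightarrow>
    (\<forall>v\<in>carrier V. \<forall>v'\<in>carrier V. \<forall>w\<in>carrier W.
      e (v \<oplus>\<^bsub>V\<^esub> v') w \<ominus>\<^bsub>F\<^esub> (e v w \<oplus>\<^bsub>F\<^esub> e v' w) \<in> X) \<and>
    (\<forall>v\<in>carrier V. \<forall>w\<in>carrier W. \<forall>w'\<in>carrier W.
      e v (w \<oplus>\<^bsub>W\<^esub> w') \<ominus>\<^bsub>F\<^esub> (e v w \<oplus>\<^bsub>F\<^esub> e v w') \<in> X) \<and>
    (\<forall>c\<in>carrier K. \<forall>v\<in>carrier V. \<forall>w\<in>carrier W.
      e (c \<odot>\<^bsub>V\<^esub> v) w \<ominus>\<^bsub>F\<^esub> (c \<odot>\<^bsub>F\<^esub> e v w) \<in> X) \<and>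
    (\<forall>c\<in>carrier K. \<forall>v\<in>carrier V. \<forall>w\<in>carrier W.
      e v (c \<odot>\<^bsub>W\<^esub> w) \<ominus>\<^bsub>F\<^esub> (c \<odot>\<^bsub>F\<^esub> e v w) \<in> X)"
  by (simp only: tensor_relations_def Let_def F_def e_def Un_subset_iff conj_assoc
      Collect3_subset_iff)

locale module_pair = V: module K V + W: module K W for K and V and W
begin

abbreviation "F \<equiv> free_module K (carrier V \<times> carrier W)"
abbreviation "N \<equiv> tensor_kernel K V W"
abbreviation "T \<equiv> tensor_module K V W"
abbreviation "pure \<equiv> pure_tensor K V W"

sublocale F: module K F
  by (rule V.R.free_module_is_module)

lemma gen_closed: "\<lbrakk>v \<in> carrier V; w \<in> carrier W\<rbrakk> \<Longrightarrow> free_gen K (v, w) \<in> carrier F"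
  by (simp add: V.R.free_gen_closed)

lemma tensor_relations_closed: "tensor_relations K V W \<subseteq> carrier F"
  unfolding tensor_relations_subset_iff
  by (intro conjI ballI F.M.minus_closed) (simp_all add: gen_closed)

sublocale TQ: quotient K F N
proof (intro quotient.intro quotient_axioms.intro)
  show "module K F" by (rule F.module_axioms)
  show "submodule N K F"
    unfolding tensor_kernel_def
    by (rule F.submodule_span_is_submodule[OF tensor_relations_closed])
qed

lemma T_is_quotient: "T = quotient_module F N"
  by (simp add: tensor_module_def)

sublocale T: module K T
  using TQ.quotient_is_module by (simp add: tensor_module_def)

text \<open>Each bilinearity law is one of the four families of relations, and the difference of its two
  sides lies in the submodule that is divided out.\<close>

lemma pure_bilinear: "bilinear_map K V W T pure"
proof -
  have rel: "N +>\<^bsub>F\<^esub> x = N +>\<^bsub>F\<^esub> y"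
    if "x \<ominus>\<^bsub>F\<^esub> y \<in> tensor_relations K V W" "x \<in> carrier F" "y \<in> carrier F" for x y
    using that submodule_span_superset[of "tensor_relations K V W" K F]
    by (intro TQ.coset_eqI) (auto simp: tensor_kernel_def)
  note relations = order_refl[of "tensor_relations K V W", unfolded tensor_relations_subset_iff]
  show ?thesis
    unfolding pure_tensor_def T_is_quotient
  proof (rule bilinear_mapI)
    fix v v' w assume "v \<in> carrier V" "v' \<in> carrier V" "w \<in> carrier W"
    then show "N +>\<^bsub>F\<^esub> free_gen K (v \<oplus>\<^bsub>V\<^esub> v', w)
        = (N +>\<^bsub>F\<^esub> free_gen K (v, w)) \<oplus>\<^bsub>quotient_module F N\<^esub> (N +>\<^bsub>F\<^esub> free_gen K (v', w))"
      by (subst TQ.coset_add)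
        (simp_all add: gen_closed rel relations)
  next
    fix v w w' assume "v \<in> carrier V" "w \<in> carrier W" "w' \<in> carrier W"
    then show "N +>\<^bsub>F\<^esub> free_gen K (v, w \<oplus>\<^bsub>W\<^esub> w')
        = (N +>\<^bsub>F\<^esub> free_gen K (v, w)) \<oplus>\<^bsub>quotient_module F N\<^esub> (N +>\<^bsub>F\<^esub> free_gen K (v, w'))"
      by (subst TQ.coset_add)
        (simp_all add: gen_closed rel relations)
  next
    fix c v w assume "c \<in> carrier K" "v \<in> carrier V" "w \<in> carrier W"
    then show "N +>\<^bsub>F\<^esub> free_gen K (c \<odot>\<^bsub>V\<^esub> v, w)
        = c \<odot>\<^bsub>quotient_module F N\<^esub> (N +>\<^bsub>F\<^esub> free_gen K (v, w))"
      by (subst TQ.coset_smult)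
        (simp_all add: gen_closed rel relations)
  next
    fix c v w assume "c \<in> carrier K" "v \<in> carrier V" "w \<in> carrier W"
    then show "N +>\<^bsub>F\<^esub> free_gen K (v, c \<odot>\<^bsub>W\<^esub> w)
        = c \<odot>\<^bsub>quotient_module F N\<^esub> (N +>\<^bsub>F\<^esub> free_gen K (v, w))"
      by (subst TQ.coset_smult)
        (simp_all add: gen_closed rel relations)
  qed (simp add: TQ.coset_closed gen_closed)
qed

lemmas pure_linear = bilinear_mapD[OF pure_bilinear]

lemma pure_closed [simp]: "\<lbrakk>v \<in> carrier V; w \<in> carrier W\<rbrakk> \<Longrightarrow> pure v w \<in> carrier T"
  using linear_map_closed[OF pure_linear(1)] by blast

text \<open>A scalar multiple of a pure tensor is again pure, since the scalar can be absorbed into the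
  first factor. So \<open>0\<close> and the multiples of generators fall under the case of pure tensors.\<close>

lemma tensor_induct [consumes 1, case_names pure add]:
  assumes t: "t \<in> carrier T"
    and pure: "\<And>v w. \<lbrakk>v \<in> carrier V; w \<in> carrier W\<rbrakk> \<Longrightarrow> P (pure v w)"
    and add: "\<And>s t. \<lbrakk>s \<in> carrier T; t \<in> carrier T; P s; P t\<rbrakk> \<Longrightarrow> P (s \<oplus>\<^bsub>T\<^esub> t)"
  shows "P t"
proof -
  obtain f where f: "f \<in> carrier F" and t_eq: "t = N +>\<^bsub>F\<^esub> f"
    using t by (auto simp: T_is_quotient TQ.quotient_carrier)
  have "P (N +>\<^bsub>F\<^esub> f)"
    using f
  proof (induction f rule: V.R.free_module_induct)
    case zero
    have "P (pure (\<zero>\<^bsub>K\<^esub> \<odot>\<^bsub>V\<^esub> \<zero>\<^bsub>V\<^esub>) \<zero>\<^bsub>W\<^esub>)"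
      by (intro pure) auto
    also have "pure (\<zero>\<^bsub>K\<^esub> \<odot>\<^bsub>V\<^esub> \<zero>\<^bsub>V\<^esub>) \<zero>\<^bsub>W\<^esub> = \<zero>\<^bsub>K\<^esub> \<odot>\<^bsub>T\<^esub> pure \<zero>\<^bsub>V\<^esub> \<zero>\<^bsub>W\<^esub>"
      by (rule linear_map_smult[OF pure_linear(2)]) auto
    also have "\<dots> = \<zero>\<^bsub>T\<^esub>" by simp
    also have "\<dots> = N +>\<^bsub>F\<^esub> \<zero>\<^bsub>F\<^esub>"
      using linear_map_zero[OF F.module_axioms TQ.quotient_is_module TQ.coset_linear]
      by (simp add: T_is_quotient)
    finally show ?case .
  next
    case (gen c p)
    then obtain v w where p: "p = (v, w)" "v \<in> carrier V" "w \<in> carrier W" by auto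
    have "P (pure (c \<odot>\<^bsub>V\<^esub> v) w)" using gen p by (intro pure) auto
    also have "pure (c \<odot>\<^bsub>V\<^esub> v) w = c \<odot>\<^bsub>T\<^esub> pure v w"
      using gen p linear_map_smult[OF pure_linear(2)] by blast
    also have "\<dots> = N +>\<^bsub>F\<^esub> (c \<odot>\<^bsub>F\<^esub> free_gen K p)"
      using gen p by (simp add: T_is_quotient TQ.coset_smult gen_closed pure_tensor_def)
    finally show ?case .
  next
    case (add f g)
    then have "P ((N +>\<^bsub>F\<^esub> f) \<oplus>\<^bsub>T\<^esub> (N +>\<^bsub>F\<^esub> g))"
      using assms(3) by (simp add: T_is_quotient TQ.coset_closed)
    then show ?case using add by (simp add: T_is_quotient TQ.coset_add)
  qed
  then show ?thesis by (simp add: t_eq)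
qed

lemma linear_map_eqI:
  assumes "linear_map K T M g" "linear_map K T M h"
    and "\<And>v w. \<lbrakk>v \<in> carrier V; w \<in> carrier W\<rbrakk> \<Longrightarrow> g (pure v w) = h (pure v w)"
    and "t \<in> carrier T"
  shows "g t = h t"
  using assms(4)
  by (induction rule: tensor_induct)
    (simp_all add: assms(3) linear_map_add[OF assms(1)] linear_map_add[OF assms(2)])

text \<open>The linear extension of \<open>\<phi>\<close> to the free module annihilates the relations because \<open>\<phi>\<close> is
  bilinear. Its kernel is a submodule, so it contains the span of the relations, and the extension
  factors through the quotient.\<close>

lemma tensor_lift_universal:
  assumes M: "module K M" and \<phi>: "bilinear_map K V W M \<phi>"
  shows "linear_map K T M (tensor_lift K M \<phi>)"
    and "\<And>v w. \<lbrakk>v \<in> carrier V; w \<in> carrier W\<rbrakk> \<Longrightarrow> tensor_lift K M \<phi> (pure v w) = \<phi> v w"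
proof -
  interpret M: module K M by fact
  let ?L = "\<lambda>f. \<Oplus>\<^bsub>M\<^esub>p\<in>{p. f p \<noteq> \<zero>\<^bsub>K\<^esub>}. f p \<odot>\<^bsub>M\<^esub> \<phi> (fst p) (snd p)"
  note \<phi>_lin = bilinear_mapD[OF \<phi>]
  have \<phi>_closed: "\<phi> v w \<in> carrier M" if "v \<in> carrier V" "w \<in> carrier W" for v w
    using that linear_map_closed[OF \<phi>_lin(1)] by blast
  have L: "linear_map K F M ?L"
    by (rule M.free_extension_linear) (auto simp: \<phi>_closed)
  have L_gen: "?L (free_gen K (v, w)) = \<phi> v w" if "v \<in> carrier V" "w \<in> carrier W" for v w
    using that by (subst M.free_extension_linear(2)[where S = "carrier V \<times> carrier W"])
      (auto simp: \<phi>_closed)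
  have "tensor_relations K V W \<subseteq> {f \<in> carrier F. ?L f = \<zero>\<^bsub>M\<^esub>}"
  proof -
    have diff: "?L (x \<ominus>\<^bsub>F\<^esub> y) = \<zero>\<^bsub>M\<^esub>" if "x \<in> carrier F" "y \<in> carrier F" "?L x = ?L y" for x y
      using that linear_map_diff[OF F.module_axioms M L, of x y] linear_map_closed[OF L, of y]
      by (simp add: a_minus_def M.M.r_neg)
    show ?thesis
      unfolding tensor_relations_subset_iff
      by (intro conjI ballI CollectI F.M.minus_closed diff)
        (simp_all add: gen_closed L_gen linear_map_add[OF L] linear_map_smult[OF L]
          linear_map_add[OF \<phi>_lin(1)] linear_map_add[OF \<phi>_lin(2)]
          linear_map_smult[OF \<phi>_lin(1)] linear_map_smult[OF \<phi>_lin(2)])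
  qed
  then have "N \<subseteq> {f \<in> carrier F. ?L f = \<zero>\<^bsub>M\<^esub>}"
    unfolding tensor_kernel_def
    by (intro submodule_span_least kernel_is_submodule F.module_axioms M L)
  then have vanish: "?L n = \<zero>\<^bsub>M\<^esub>" if "n \<in> N" for n using that by auto
  have eq: "tensor_lift K M \<phi> = (\<lambda>t. the_elem (?L ` t))"
    by (simp add: tensor_lift_def fun_eq_iff)
  show "linear_map K T M (tensor_lift K M \<phi>)"
    unfolding eq T_is_quotient using M L vanish by (rule TQ.factor_map)
  fix v w assume "v \<in> carrier V" "w \<in> carrier W"
  then show "tensor_lift K M \<phi> (pure v w) = \<phi> v w"
    using TQ.factor_map(1)[OF M L vanish, of "free_gen K (v, w)"]
    by (simp add: eq pure_tensor_def gen_closed L_gen)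
qed

text \<open>Lifting depends linearly on the bilinear map. The product of a tensor algebra is a lift of
  lifts, and this lemma gives its linearity in the arguments that occur as parameters of a lift.\<close>

lemma tensor_lift_family_linear:
  assumes "module K X" "module K M"
    and bilinear: "\<And>x. x \<in> carrier X \<Longrightarrow> bilinear_map K V W M (\<phi> x)"
    and linear: "\<And>v w. \<lbrakk>v \<in> carrier V; w \<in> carrier W\<rbrakk> \<Longrightarrow> linear_map K X M (\<lambda>x. \<phi> x v w)"
    and "t \<in> carrier T"
  shows "linear_map K X M (\<lambda>x. tensor_lift K M (\<phi> x) t)"
  using assms(5)
proof (induction rule: tensor_induct)
  case (pure v w)
  then show ?case
    by (intro linear_map_cong[OF assms(1) linear])
      (simp_all add: tensor_lift_universal(2)[OF assms(2) bilinear])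
next
  case (add s t)
  show ?case
    by (rule linear_map_cong[OF assms(1) linear_map_sum[OF assms(2) add.IH]])
      (rule linear_map_add[OF tensor_lift_universal(1)[OF assms(2) bilinear] add.hyps])
qed

end


section \<open>Algebras\<close>

lemma unital_algebraI:
  assumes "field K" and "module K M"
    and "\<And>x y. \<lbrakk>x \<in> carrier M; y \<in> carrier M\<rbrakk> \<Longrightarrow> x \<otimes>\<^bsub>M\<^esub> y \<in> carrier M"
    and "\<one>\<^bsub>M\<^esub> \<in> carrier M"
    and "\<And>x y z. \<lbrakk>x \<in> carrier M; y \<in> carrier M; z \<in> carrier M\<rbrakk>
      \<Longrightarrow> (x \<otimes>\<^bsub>M\<^esub> y) \<otimes>\<^bsub>M\<^esub> z = x \<otimes>\<^bsub>M\<^esub> (y \<otimes>\<^bsub>M\<^esub> z)"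
    and "\<And>x. x \<in> carrier M \<Longrightarrow> \<one>\<^bsub>M\<^esub> \<otimes>\<^bsub>M\<^esub> x = x"
    and "\<And>x. x \<in> carrier M \<Longrightarrow> x \<otimes>\<^bsub>M\<^esub> \<one>\<^bsub>M\<^esub> = x"
    and bilinear: "bilinear_map K M M M (\<otimes>\<^bsub>M\<^esub>)"
  shows "unital_algebra K M"
proof (intro unital_algebra.intro unital_algebra_axioms.intro ringI monoidI)
  show "abelian_group M" using assms(2) by (simp add: module_def)
qed (simp_all add: assms linear_map_add[OF bilinear_mapD(1)[OF bilinear]]
      linear_map_add[OF bilinear_mapD(2)[OF bilinear]]
      linear_map_smult[OF bilinear_mapD(1)[OF bilinear]]
      linear_map_smult[OF bilinear_mapD(2)[OF bilinear]])

lemma (in unital_algebra) mult_bilinear: "bilinear_map K A A A (\<otimes>\<^bsub>A\<^esub>)"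
  by (rule bilinear_mapI)
    (simp_all add: l_distr r_distr smult_mult_left smult_mult_right)

text \<open>Zero and negatives are the multiples by \<open>0\<close> and \<open>-1\<close>, so closure under scalars provides
  them.\<close>

lemma (in unital_algebra) subalgebra:
  assumes subset: "S \<subseteq> carrier A" and one: "\<one>\<^bsub>A\<^esub> \<in> S"
    and add: "\<And>x y. \<lbrakk>x \<in> S; y \<in> S\<rbrakk> \<Longrightarrow> x \<oplus>\<^bsub>A\<^esub> y \<in> S"
    and mult: "\<And>x y. \<lbrakk>x \<in> S; y \<in> S\<rbrakk> \<Longrightarrow> x \<otimes>\<^bsub>A\<^esub> y \<in> S"
    and smult: "\<And>c x. \<lbrakk>c \<in> carrier K; x \<in> S\<rbrakk> \<Longrightarrow> c \<odot>\<^bsub>A\<^esub> x \<in> S"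
  shows "unital_algebra K (A\<lparr>carrier := S\<rparr>)"
proof (rule unital_algebraI)
  note S = subsetD[OF subset]
  have "submodule S K A"
  proof (rule submoduleI)
    show "\<zero>\<^bsub>A\<^esub> \<in> S" using smult[OF R.zero_closed one] by simp
    show "\<ominus>\<^bsub>A\<^esub> x \<in> S" if "x \<in> S" for x
      using smult[of "\<ominus> \<one>" x] that S[OF that] smult_l_minus[of \<one> x] by simp
  qed (use assms in simp_all)
  then show "module K (A\<lparr>carrier := S\<rparr>)"
    by (rule submodule.submodule_is_module) (rule module_axioms)
  show "bilinear_map K (A\<lparr>carrier := S\<rparr>) (A\<lparr>carrier := S\<rparr>) (A\<lparr>carrier := S\<rparr>)
      (\<otimes>\<^bsub>A\<lparr>carrier := S\<rparr>\<^esub>)"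
    by (rule bilinear_mapI)
      (simp_all add: mult S l_distr r_distr smult_mult_left smult_mult_right)
qed (simp_all add: one mult subsetD[OF subset] m_assoc field_axioms)

lemma (in unital_algebra) opposite_unital_algebra: "unital_algebra K (opposite A)"
proof (rule unital_algebraI)
  show "module K (opposite A)"
    by (rule module_cong[OF module_axioms]) (simp_all add: opposite_def)
  show "bilinear_map K (opposite A) (opposite A) (opposite A) (\<otimes>\<^bsub>opposite A\<^esub>)"
    by (rule bilinear_mapI)
      (simp_all add: opposite_def l_distr r_distr smult_mult_left smult_mult_right)
qed (simp_all add: opposite_def m_assoc field_axioms)

text \<open>Every law is checked pointwise, since endomorphisms are determined by their values on the
  carrier.\<close>

lemma End_algebra_unital_algebra:
  assumes "field K" and "module K M"
  shows "unital_algebra K (End_algebra K M)"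
proof -
  let ?E = "End_algebra K M"
  interpret M: module K M by fact
  have E_iff: "\<psi> \<in> carrier ?E \<longleftrightarrow> \<psi> \<in> extensional (carrier M) \<and> linear_map K M M \<psi>" for \<psi>
    by (auto simp: End_algebra_def linear_map_def PiE_def)
  have restrict_closed: "restrict h (carrier M) \<in> carrier ?E" if "linear_map K M M h" for h
    using that by (simp add: E_iff linear_map_def)
  have ext: "\<psi> = \<chi>"
    if "\<psi> \<in> carrier ?E" "\<chi> \<in> carrier ?E" "\<And>x. x \<in> carrier M \<Longrightarrow> \<psi> x = \<chi> x" for \<psi> \<chi>
    using that by (auto simp: E_iff intro: extensionalityI)
  have linear: "linear_map K M M \<psi>" if "\<psi> \<in> carrier ?E" for \<psi>
    using that by (simp add: E_iff)
  note lin_simps = linear_map_closed[OF linear] linear_map_add[OF linear] linear_map_smult[OF linear]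
  have [simp]: "(\<psi> \<oplus>\<^bsub>?E\<^esub> \<chi>) x = \<psi> x \<oplus>\<^bsub>M\<^esub> \<chi> x" "(\<psi> \<otimes>\<^bsub>?E\<^esub> \<chi>) x = \<psi> (\<chi> x)"
    "\<zero>\<^bsub>?E\<^esub> x = \<zero>\<^bsub>M\<^esub>" "\<one>\<^bsub>?E\<^esub> x = x" "(c \<odot>\<^bsub>?E\<^esub> \<psi>) x = c \<odot>\<^bsub>M\<^esub> \<psi> x"
    if "x \<in> carrier M" for \<psi> \<chi> c x
    using that by (simp_all add: End_algebra_def compose_def)
  have [simp]: "\<psi> \<oplus>\<^bsub>?E\<^esub> \<chi> \<in> carrier ?E" if "\<psi> \<in> carrier ?E" "\<chi> \<in> carrier ?E" for \<psi> \<chi>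
    using restrict_closed[OF linear_map_sum[OF M.module_axioms linear linear], OF that]
    by (simp add: End_algebra_def)
  have [simp]: "\<psi> \<otimes>\<^bsub>?E\<^esub> \<chi> \<in> carrier ?E" if "\<psi> \<in> carrier ?E" "\<chi> \<in> carrier ?E" for \<psi> \<chi>
    using restrict_closed[OF linear_map_comp[OF linear linear], OF that(2,1)]
    by (simp add: End_algebra_def compose_def)
  have [simp]: "\<one>\<^bsub>?E\<^esub> \<in> carrier ?E"
    using restrict_closed[OF linear_map_ident] by (simp add: End_algebra_def)
  have [simp]: "\<zero>\<^bsub>?E\<^esub> \<in> carrier ?E"
    using restrict_closed[of "\<lambda>_. \<zero>\<^bsub>M\<^esub>"] by (simp add: End_algebra_def linear_map_def)
  have [simp]: "c \<odot>\<^bsub>?E\<^esub> \<psi> \<in> carrier ?E" if "c \<in> carrier K" "\<psi> \<in> carrier ?E" for c \<psi>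
    using restrict_closed[OF linear_map_comp[OF linear M.smult_linear], OF that(2,1)]
    by (simp add: End_algebra_def)
  have "abelian_group ?E"
  proof (rule abelian_groupI)
    fix \<psi> assume \<psi>: "\<psi> \<in> carrier ?E"
    show "\<exists>\<chi>\<in>carrier ?E. \<chi> \<oplus>\<^bsub>?E\<^esub> \<psi> = \<zero>\<^bsub>?E\<^esub>"
      using \<psi> by (intro bexI[of _ "(\<ominus>\<^bsub>K\<^esub> \<one>\<^bsub>K\<^esub>) \<odot>\<^bsub>?E\<^esub> \<psi>"] ext)
        (simp_all add: lin_simps M.smult_l_minus M.M.l_neg)
  qed (auto intro!: ext simp: lin_simps M.M.a_ac)
  then have module: "module K ?E"
    by (intro moduleI[OF M.R.is_cring])
      (auto intro!: ext simp: lin_simps M.smult_l_distr M.smult_r_distr M.smult_assoc1)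
  show ?thesis
  proof (rule unital_algebraI[OF assms(1) module])
    show "bilinear_map K ?E ?E ?E (\<otimes>\<^bsub>?E\<^esub>)"
      by (rule bilinear_mapI) (auto intro!: ext simp: lin_simps)
  qed (auto intro!: ext simp: lin_simps)
qed


section \<open>Tensor products of algebras\<close>

locale algebra_pair = A: unital_algebra K A + B: unital_algebra K B for K and A and B
begin

sublocale module_pair K A B
  by (intro module_pair.intro A.module_axioms B.module_axioms)

abbreviation "TA \<equiv> tensor_algebra K A B"

lemma tensor_algebra_simps [simp]:
  "carrier TA = carrier T" "\<one>\<^bsub>TA\<^esub> = pure \<one>\<^bsub>A\<^esub> \<one>\<^bsub>B\<^esub>"
  "(\<oplus>\<^bsub>TA\<^esub>) = (\<oplus>\<^bsub>T\<^esub>)" "\<zero>\<^bsub>TA\<^esub> = \<zero>\<^bsub>T\<^esub>" "(\<odot>\<^bsub>TA\<^esub>) = (\<odot>\<^bsub>T\<^esub>)"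
  by (simp_all add: tensor_algebra_def Let_def)

text \<open>\<open>L t\<close> below is the bilinear map \<open>(a, b) \<mapsto> (a \<otimes> b) t\<close> whose lift, applied to \<open>s\<close>, is \<open>s t\<close>.
  It is bilinear because the inner lift depends linearly on its parameters \<open>a\<close> and \<open>b\<close>; the product
  is linear in \<open>t\<close> because \<open>L t\<close> depends linearly on \<open>t\<close>.\<close>

lemma tensor_mult_bilinear: "bilinear_map K T T T (\<otimes>\<^bsub>TA\<^esub>)"
  and pure_mult_pure: "\<lbrakk>a \<in> carrier A; b \<in> carrier B; a' \<in> carrier A; b' \<in> carrier B\<rbrakk>
    \<Longrightarrow> pure a b \<otimes>\<^bsub>TA\<^esub> pure a' b' = pure (a \<otimes>\<^bsub>A\<^esub> a') (b \<otimes>\<^bsub>B\<^esub> b')"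
proof -
  define L where
    "L = (\<lambda>t a b. tensor_lift K T (\<lambda>a' b'. pure (a \<otimes>\<^bsub>A\<^esub> a') (b \<otimes>\<^bsub>B\<^esub> b')) t)"
  have mult: "(\<otimes>\<^bsub>TA\<^esub>) = (\<lambda>s t. tensor_lift K T (L t) s)"
    by (simp add: tensor_algebra_def Let_def L_def)
  have inner: "bilinear_map K A B T (\<lambda>a' b'. pure (a \<otimes>\<^bsub>A\<^esub> a') (b \<otimes>\<^bsub>B\<^esub> b'))"
    if "a \<in> carrier A" "b \<in> carrier B" for a b
    by (rule bilinear_map_comp[OF pure_bilinear bilinear_mapD(1)[OF A.mult_bilinear that(1)]
          bilinear_mapD(1)[OF B.mult_bilinear that(2)]])
  have outer: "bilinear_map K A B T (\<lambda>a b. pure (a \<otimes>\<^bsub>A\<^esub> a') (b \<otimes>\<^bsub>B\<^esub> b'))"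
    if "a' \<in> carrier A" "b' \<in> carrier B" for a' b'
    by (rule bilinear_map_comp[OF pure_bilinear bilinear_mapD(2)[OF A.mult_bilinear that(1)]
          bilinear_mapD(2)[OF B.mult_bilinear that(2)]])
  have L: "bilinear_map K A B T (L t)" if t: "t \<in> carrier T" for t
    unfolding bilinear_map_def L_def
  proof (intro conjI ballI)
    show "linear_map K B T
        (\<lambda>b. tensor_lift K T (\<lambda>a' b'. pure (a \<otimes>\<^bsub>A\<^esub> a') (b \<otimes>\<^bsub>B\<^esub> b')) t)" if "a \<in> carrier A" for a
      by (rule tensor_lift_family_linear[OF B.module_axioms T.module_axioms inner _ t])
        (use that bilinear_mapD(1)[OF outer] in auto)
    show "linear_map K A T
        (\<lambda>a. tensor_lift K T (\<lambda>a' b'. pure (a \<otimes>\<^bsub>A\<^esub> a') (b \<otimes>\<^bsub>B\<^esub> b')) t)" if "b \<in> carrier B" for b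
      by (rule tensor_lift_family_linear[OF A.module_axioms T.module_axioms inner _ t])
        (use that bilinear_mapD(2)[OF outer] in auto)
  qed
  show "bilinear_map K T T T (\<otimes>\<^bsub>TA\<^esub>)"
    unfolding mult bilinear_map_def
  proof (intro conjI ballI)
    show "linear_map K T T (\<lambda>s. tensor_lift K T (L t) s)" if "t \<in> carrier T" for t
      by (rule tensor_lift_universal(1)[OF T.module_axioms L[OF that]])
    show "linear_map K T T (\<lambda>t. tensor_lift K T (L t) s)" if s: "s \<in> carrier T" for s
    proof (rule tensor_lift_family_linear[OF T.module_axioms T.module_axioms L _ s])
      fix a b assume "a \<in> carrier A" "b \<in> carrier B"
      then show "linear_map K T T (\<lambda>t. L t a b)"
        unfolding L_def by (intro tensor_lift_universal(1)[OF T.module_axioms inner])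
    qed
  qed
  assume "a \<in> carrier A" "b \<in> carrier B" "a' \<in> carrier A" "b' \<in> carrier B"
  then show "pure a b \<otimes>\<^bsub>TA\<^esub> pure a' b' = pure (a \<otimes>\<^bsub>A\<^esub> a') (b \<otimes>\<^bsub>B\<^esub> b')"
    by (simp add: mult tensor_lift_universal(2)[OF T.module_axioms L], simp add: L_def
        tensor_lift_universal(2)[OF T.module_axioms inner])
qed

lemmas tensor_mult_linear = bilinear_mapD[OF tensor_mult_bilinear]

lemma tensor_mult_closed: "\<lbrakk>s \<in> carrier T; t \<in> carrier T\<rbrakk> \<Longrightarrow> s \<otimes>\<^bsub>TA\<^esub> t \<in> carrier T"
  by (rule linear_map_closed[OF tensor_mult_linear(1)])

text \<open>Both sides are linear in each argument, so the three arguments can be replaced by pure tensors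
  one after the other.\<close>

lemma tensor_mult_assoc:
  assumes r: "r \<in> carrier T" and s: "s \<in> carrier T" and t: "t \<in> carrier T"
  shows "(r \<otimes>\<^bsub>TA\<^esub> s) \<otimes>\<^bsub>TA\<^esub> t = r \<otimes>\<^bsub>TA\<^esub> (s \<otimes>\<^bsub>TA\<^esub> t)"
proof (rule linear_map_eqI[where g = "\<lambda>r. (r \<otimes>\<^bsub>TA\<^esub> s) \<otimes>\<^bsub>TA\<^esub> t"
      and h = "\<lambda>r. r \<otimes>\<^bsub>TA\<^esub> (s \<otimes>\<^bsub>TA\<^esub> t)", OF _ _ _ r])
  show "linear_map K T T (\<lambda>r. (r \<otimes>\<^bsub>TA\<^esub> s) \<otimes>\<^bsub>TA\<^esub> t)"
    using s t by (intro linear_map_comp[OF tensor_mult_linear(2) tensor_mult_linear(2)])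
  show "linear_map K T T (\<lambda>r. r \<otimes>\<^bsub>TA\<^esub> (s \<otimes>\<^bsub>TA\<^esub> t))"
    using s t by (intro tensor_mult_linear(2) tensor_mult_closed)
  fix a1 b1 assume 1: "a1 \<in> carrier A" "b1 \<in> carrier B"
  show "(pure a1 b1 \<otimes>\<^bsub>TA\<^esub> s) \<otimes>\<^bsub>TA\<^esub> t = pure a1 b1 \<otimes>\<^bsub>TA\<^esub> (s \<otimes>\<^bsub>TA\<^esub> t)"
  proof (rule linear_map_eqI[where g = "\<lambda>s. (pure a1 b1 \<otimes>\<^bsub>TA\<^esub> s) \<otimes>\<^bsub>TA\<^esub> t"
        and h = "\<lambda>s. pure a1 b1 \<otimes>\<^bsub>TA\<^esub> (s \<otimes>\<^bsub>TA\<^esub> t)", OF _ _ _ s])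
    show "linear_map K T T (\<lambda>s. (pure a1 b1 \<otimes>\<^bsub>TA\<^esub> s) \<otimes>\<^bsub>TA\<^esub> t)"
      using 1 t by (intro linear_map_comp[OF tensor_mult_linear(1) tensor_mult_linear(2)] pure_closed)
    show "linear_map K T T (\<lambda>s. pure a1 b1 \<otimes>\<^bsub>TA\<^esub> (s \<otimes>\<^bsub>TA\<^esub> t))"
      using 1 t by (intro linear_map_comp[OF tensor_mult_linear(2) tensor_mult_linear(1)] pure_closed)
    fix a2 b2 assume 2: "a2 \<in> carrier A" "b2 \<in> carrier B"
    show "(pure a1 b1 \<otimes>\<^bsub>TA\<^esub> pure a2 b2) \<otimes>\<^bsub>TA\<^esub> t = pure a1 b1 \<otimes>\<^bsub>TA\<^esub> (pure a2 b2 \<otimes>\<^bsub>TA\<^esub> t)"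
    proof (rule linear_map_eqI[where g = "\<lambda>t. (pure a1 b1 \<otimes>\<^bsub>TA\<^esub> pure a2 b2) \<otimes>\<^bsub>TA\<^esub> t"
        and h = "\<lambda>t. pure a1 b1 \<otimes>\<^bsub>TA\<^esub> (pure a2 b2 \<otimes>\<^bsub>TA\<^esub> t)", OF _ _ _ t])
      show "linear_map K T T (\<lambda>t. (pure a1 b1 \<otimes>\<^bsub>TA\<^esub> pure a2 b2) \<otimes>\<^bsub>TA\<^esub> t)"
        using 1 2 by (intro tensor_mult_linear(1) tensor_mult_closed pure_closed)
      show "linear_map K T T (\<lambda>t. pure a1 b1 \<otimes>\<^bsub>TA\<^esub> (pure a2 b2 \<otimes>\<^bsub>TA\<^esub> t))"
        using 1 2
        by (intro linear_map_comp[OF tensor_mult_linear(1) tensor_mult_linear(1)] pure_closed)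
    qed (simp add: 1 2 pure_mult_pure A.m_assoc B.m_assoc)
  qed
qed

theorem tensor_algebra_unital_algebra: "unital_algebra K TA"
proof (rule unital_algebraI)
  show "field K" by (rule A.field_axioms)
  show "module K TA"
    by (rule module_cong[OF T.module_axioms]) simp_all
  show "bilinear_map K TA TA TA (\<otimes>\<^bsub>TA\<^esub>)"
    using tensor_mult_bilinear by (simp add: bilinear_map_def linear_map_def)
  fix t assume t: "t \<in> carrier TA"
  show "\<one>\<^bsub>TA\<^esub> \<otimes>\<^bsub>TA\<^esub> t = t"
    by (rule linear_map_eqI[OF tensor_mult_linear(1) linear_map_ident])
      (use t in \<open>simp_all add: pure_mult_pure\<close>)
  show "t \<otimes>\<^bsub>TA\<^esub> \<one>\<^bsub>TA\<^esub> = t"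
    by (rule linear_map_eqI[OF tensor_mult_linear(2) linear_map_ident])
      (use t in \<open>simp_all add: pure_mult_pure\<close>)
qed (simp_all add: tensor_mult_closed tensor_mult_assoc)

end


section \<open>Bimodule endomorphisms of the tensor product\<close>

text \<open>The carrier of \<open>tw\<close> consists of endomorphisms of \<open>B \<otimes> A\<close>, and its target is \<open>A \<otimes> B\<^sup>o\<^sup>p\<close>; the
  two tensor products are interpreted side by side, with prefixes \<open>BA\<close> and \<open>AB\<close>.\<close>

locale algebra_twists = A: unital_algebra K A + B: unital_algebra K B for K and A and B
begin

sublocale BA: algebra_pair K B A
  by (intro algebra_pair.intro A.unital_algebra_axioms B.unital_algebra_axioms)

sublocale AB: algebra_pair K A "opposite B"
  by (intro algebra_pair.intro A.unital_algebra_axioms B.opposite_unital_algebra)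

abbreviation "C \<equiv> tensor_algebra K A (opposite B)"

sublocale C: unital_algebra K C
  by (rule AB.tensor_algebra_unital_algebra)

abbreviation "lact \<equiv> left_action K B A"
abbreviation "ract \<equiv> right_action K B A"
abbreviation "unit_tensor \<equiv> BA.pure \<one>\<^bsub>B\<^esub> \<one>\<^bsub>A\<^esub>"

lemma opposite_simps [simp]:
  "carrier (opposite B) = carrier B" "\<one>\<^bsub>opposite B\<^esub> = \<one>\<^bsub>B\<^esub>"
  "b \<otimes>\<^bsub>opposite B\<^esub> b' = b' \<otimes>\<^bsub>B\<^esub> b"
  "(\<oplus>\<^bsub>opposite B\<^esub>) = (\<oplus>\<^bsub>B\<^esub>)" "(\<odot>\<^bsub>opposite B\<^esub>) = (\<odot>\<^bsub>B\<^esub>)"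
  by (simp_all add: opposite_def)

lemma lact:
  assumes "b' \<in> carrier B"
  shows "linear_map K BA.T BA.T (lact b')"
    and "\<lbrakk>b \<in> carrier B; a \<in> carrier A\<rbrakk> \<Longrightarrow> lact b' (BA.pure b a) = BA.pure (b' \<otimes>\<^bsub>B\<^esub> b) a"
proof -
  have "bilinear_map K B A BA.T (\<lambda>b a. BA.pure (b' \<otimes>\<^bsub>B\<^esub> b) a)"
    by (rule bilinear_map_comp[OF BA.pure_bilinear bilinear_mapD(1)[OF B.mult_bilinear assms]
          linear_map_ident])
  note lift = BA.tensor_lift_universal[OF BA.T.module_axioms this]
  show "linear_map K BA.T BA.T (lact b')"
    unfolding left_action_def by (rule lift(1))
  show "\<lbrakk>b \<in> carrier B; a \<in> carrier A\<rbrakk> \<Longrightarrow> lact b' (BA.pure b a) = BA.pure (b' \<otimes>\<^bsub>B\<^esub> b) a"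
    unfolding left_action_def by (rule lift(2))
qed

lemma ract:
  assumes "a' \<in> carrier A"
  shows "linear_map K BA.T BA.T (\<lambda>t. ract t a')"
    and "\<lbrakk>b \<in> carrier B; a \<in> carrier A\<rbrakk> \<Longrightarrow> ract (BA.pure b a) a' = BA.pure b (a \<otimes>\<^bsub>A\<^esub> a')"
proof -
  have "bilinear_map K B A BA.T (\<lambda>b a. BA.pure b (a \<otimes>\<^bsub>A\<^esub> a'))"
    by (rule bilinear_map_comp[OF BA.pure_bilinear linear_map_ident
          bilinear_mapD(2)[OF A.mult_bilinear assms]])
  note lift = BA.tensor_lift_universal[OF BA.T.module_axioms this]
  show "linear_map K BA.T BA.T (\<lambda>t. ract t a')"
    unfolding right_action_def by (rule lift(1))
  show "\<lbrakk>b \<in> carrier B; a \<in> carrier A\<rbrakk> \<Longrightarrow> ract (BA.pure b a) a' = BA.pure b (a \<otimes>\<^bsub>A\<^esub> a')"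
    unfolding right_action_def by (rule lift(2))
qed

lemma tw_iff:
  "\<psi> \<in> carrier (tw K A B) \<longleftrightarrow> \<psi> \<in> extensional (carrier BA.T) \<and> linear_map K BA.T BA.T \<psi> \<and>
    (\<forall>b\<in>carrier B. \<forall>t\<in>carrier BA.T. \<psi> (lact b t) = lact b (\<psi> t)) \<and>
    (\<forall>a\<in>carrier A. \<forall>t\<in>carrier BA.T. \<psi> (ract t a) = ract (\<psi> t) a)"
  by (simp add: tw_def Let_def End_algebra_def linear_map_def PiE_def Pi_iff conj_ac)

lemma tw_closed:
  "\<lbrakk>\<psi> \<in> carrier (tw K A B); t \<in> carrier BA.T\<rbrakk> \<Longrightarrow> \<psi> t \<in> carrier BA.T"
  using linear_map_closed[of K BA.T BA.T \<psi> t] by (simp add: tw_iff)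

lemma tw_simps:
  "\<one>\<^bsub>tw K A B\<^esub> = (\<lambda>t\<in>carrier BA.T. t)"
  "\<psi> \<oplus>\<^bsub>tw K A B\<^esub> \<chi> = (\<lambda>t\<in>carrier BA.T. \<psi> t \<oplus>\<^bsub>BA.T\<^esub> \<chi> t)"
  "\<psi> \<otimes>\<^bsub>tw K A B\<^esub> \<chi> = (\<lambda>t\<in>carrier BA.T. \<psi> (\<chi> t))"
  "c \<odot>\<^bsub>tw K A B\<^esub> \<psi> = (\<lambda>t\<in>carrier BA.T. c \<odot>\<^bsub>BA.T\<^esub> \<psi> t)"
  by (simp_all add: tw_def Let_def End_algebra_def compose_def)

lemma tw_unital_algebra: "unital_algebra K (tw K A B)"
proof -
  interpret E: unital_algebra K "End_algebra K BA.T"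
    by (rule End_algebra_unital_algebra[OF A.field_axioms BA.T.module_axioms])
  let ?E = "End_algebra K BA.T"
  let ?S = "carrier (tw K A B)"
  have tw_eq: "tw K A B = ?E\<lparr>carrier := ?S\<rparr>"
    by (simp add: tw_def Let_def)
  have S_iff: "\<psi> \<in> ?S \<longleftrightarrow> \<psi> \<in> carrier ?E \<and>
      (\<forall>b\<in>carrier B. \<forall>t\<in>carrier BA.T. \<psi> (lact b t) = lact b (\<psi> t)) \<and>
      (\<forall>a\<in>carrier A. \<forall>t\<in>carrier BA.T. \<psi> (ract t a) = ract (\<psi> t) a)" for \<psi>
    by (simp add: tw_def Let_def)
  note act_simps = tw_closed linear_map_closed[OF lact(1)] linear_map_closed[OF ract(1)]
    linear_map_add[OF lact(1)] linear_map_add[OF ract(1)]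
    linear_map_smult[OF lact(1)] linear_map_smult[OF ract(1)]
  have "unital_algebra K (?E\<lparr>carrier := ?S\<rparr>)"
  proof (rule E.subalgebra)
    show "?S \<subseteq> carrier ?E" by (auto simp: S_iff)
    then have SE: "\<psi> \<in> carrier ?E" if "\<psi> \<in> ?S" for \<psi> using that by blast
    have tw_l: "\<psi> (lact b t) = lact b (\<psi> t)"
      if "\<psi> \<in> ?S" "b \<in> carrier B" "t \<in> carrier BA.T" for \<psi> b t
      using that by (simp add: S_iff)
    have tw_r: "\<psi> (ract t a) = ract (\<psi> t) a"
      if "\<psi> \<in> ?S" "a \<in> carrier A" "t \<in> carrier BA.T" for \<psi> a t
      using that by (simp add: S_iff)
    have S_I: "\<psi> \<in> ?S" if "\<psi> \<in> carrier ?E"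
      "\<And>b t. \<lbrakk>b \<in> carrier B; t \<in> carrier BA.T\<rbrakk> \<Longrightarrow> \<psi> (lact b t) = lact b (\<psi> t)"
      "\<And>a t. \<lbrakk>a \<in> carrier A; t \<in> carrier BA.T\<rbrakk> \<Longrightarrow> \<psi> (ract t a) = ract (\<psi> t) a" for \<psi>
      using that by (simp add: S_iff)
    have E_apply: "\<one>\<^bsub>?E\<^esub> t = t" "(c \<odot>\<^bsub>?E\<^esub> \<psi>) t = c \<odot>\<^bsub>BA.T\<^esub> \<psi> t"
      "(\<psi> \<oplus>\<^bsub>?E\<^esub> \<chi>) t = \<psi> t \<oplus>\<^bsub>BA.T\<^esub> \<chi> t" "(\<psi> \<otimes>\<^bsub>?E\<^esub> \<chi>) t = \<psi> (\<chi> t)"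
      if "t \<in> carrier BA.T" for c \<psi> \<chi> t
      using that by (simp_all add: End_algebra_def compose_def)
    show "\<one>\<^bsub>?E\<^esub> \<in> ?S"
      by (rule S_I) (simp_all add: E_apply act_simps)
    fix \<psi> assume \<psi>: "\<psi> \<in> ?S"
    show "c \<odot>\<^bsub>?E\<^esub> \<psi> \<in> ?S" if "c \<in> carrier K" for c
      by (rule S_I) (simp_all add: that \<psi> SE E_apply act_simps tw_l tw_r)
    fix \<chi> assume \<chi>: "\<chi> \<in> ?S"
    show "\<psi> \<oplus>\<^bsub>?E\<^esub> \<chi> \<in> ?S"
      by (rule S_I) (simp_all add: \<psi> \<chi> SE E_apply act_simps tw_l tw_r)
    show "\<psi> \<otimes>\<^bsub>?E\<^esub> \<chi> \<in> ?S"
      by (rule S_I) (simp_all add: \<psi> \<chi> SE E_apply act_simps tw_l tw_r)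
  qed
  then show ?thesis by (simp only: tw_eq[symmetric])
qed

text \<open>\<open>B\<close> and \<open>B\<^sup>o\<^sup>p\<close> are the same module, so exchanging the factors is a linear isomorphism from
  \<open>B \<otimes> A\<close> to \<open>A \<otimes> B\<^sup>o\<^sup>p\<close>.\<close>

definition swap where "swap = tensor_lift K AB.T (\<lambda>b a. AB.pure a b)"

definition unswap where "unswap = tensor_lift K BA.T (\<lambda>a b. BA.pure b a)"

lemma swap_linear: "linear_map K BA.T AB.T swap"
  and swap_pure: "\<lbrakk>b \<in> carrier B; a \<in> carrier A\<rbrakk> \<Longrightarrow> swap (BA.pure b a) = AB.pure a b"
proof -
  have "bilinear_map K B A AB.T (\<lambda>b a. AB.pure a b)"
    using bilinear_map_flip[OF AB.pure_bilinear] by (simp add: bilinear_map_def linear_map_def)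
  note lift = BA.tensor_lift_universal[OF AB.T.module_axioms this]
  show "linear_map K BA.T AB.T swap"
    unfolding swap_def by (rule lift(1))
  show "\<lbrakk>b \<in> carrier B; a \<in> carrier A\<rbrakk> \<Longrightarrow> swap (BA.pure b a) = AB.pure a b"
    unfolding swap_def by (rule lift(2))
qed

lemma unswap_linear: "linear_map K AB.T BA.T unswap"
  and unswap_pure: "\<lbrakk>a \<in> carrier A; b \<in> carrier B\<rbrakk> \<Longrightarrow> unswap (AB.pure a b) = BA.pure b a"
proof -
  have "bilinear_map K A (opposite B) BA.T (\<lambda>a b. BA.pure b a)"
    using bilinear_map_flip[OF BA.pure_bilinear] by (simp add: bilinear_map_def linear_map_def)
  note lift = AB.tensor_lift_universal[OF BA.T.module_axioms this]
  show "linear_map K AB.T BA.T unswap"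
    unfolding unswap_def by (rule lift(1))
  show "\<lbrakk>a \<in> carrier A; b \<in> carrier B\<rbrakk> \<Longrightarrow> unswap (AB.pure a b) = BA.pure b a"
    unfolding unswap_def by (rule lift(2)) simp_all
qed

lemmas swap_closed = linear_map_closed[OF swap_linear]

lemmas unswap_closed = linear_map_closed[OF unswap_linear]

lemma unswap_swap: "t \<in> carrier BA.T \<Longrightarrow> unswap (swap t) = t"
  by (rule BA.linear_map_eqI[OF linear_map_comp[OF swap_linear unswap_linear] linear_map_ident])
    (simp_all add: swap_pure unswap_pure)

lemma swap_unswap: "u \<in> carrier AB.T \<Longrightarrow> swap (unswap u) = u"
  by (rule AB.linear_map_eqI[OF linear_map_comp[OF unswap_linear swap_linear] linear_map_ident])
    (simp_all add: swap_pure unswap_pure)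

lemma swap_unit: "swap unit_tensor = \<one>\<^bsub>C\<^esub>"
  by (simp add: swap_pure)

text \<open>The product \<open>(a \<otimes> b') (1 \<otimes> b) = a \<otimes> b b'\<close> in \<open>A \<otimes> B\<^sup>o\<^sup>p\<close> reverses the factors from \<open>B\<close>: this
  is why the left action of \<open>B\<close> turns into a right multiplication and the opposite of \<open>B\<close> appears.\<close>

lemma swap_lact:
  assumes "b \<in> carrier B" "t \<in> carrier BA.T"
  shows "swap (lact b t) = swap t \<otimes>\<^bsub>C\<^esub> AB.pure \<one>\<^bsub>A\<^esub> b"
  by (rule BA.linear_map_eqI[OF linear_map_comp[OF lact(1)[OF assms(1)] swap_linear]
        linear_map_comp[OF swap_linear AB.tensor_mult_linear(2)] _ assms(2)])
    (simp_all add: assms lact(2) swap_pure AB.pure_mult_pure)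

lemma swap_ract:
  assumes "a \<in> carrier A" "t \<in> carrier BA.T"
  shows "swap (ract t a) = swap t \<otimes>\<^bsub>C\<^esub> AB.pure a \<one>\<^bsub>B\<^esub>"
  by (rule BA.linear_map_eqI[OF linear_map_comp[OF ract(1)[OF assms(1)] swap_linear]
        linear_map_comp[OF swap_linear AB.tensor_mult_linear(2)] _ assms(2)])
    (simp_all add: assms ract(2) swap_pure AB.pure_mult_pure)

text \<open>Because \<open>b \<otimes> a = b \<cdot> (1 \<otimes> 1) \<cdot> a\<close>, a bimodule map \<open>\<psi>\<close> is determined by its value at
  \<open>1 \<otimes> 1\<close>. After the exchange of factors it is left multiplication by that value.\<close>

lemma swap_tw:
  assumes \<psi>: "\<psi> \<in> carrier (tw K A B)" and t: "t \<in> carrier BA.T"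
  shows "swap (\<psi> t) = swap (\<psi> unit_tensor) \<otimes>\<^bsub>C\<^esub> swap t"
proof -
  have lin: "linear_map K BA.T BA.T \<psi>"
    and l: "\<And>b t. \<lbrakk>b \<in> carrier B; t \<in> carrier BA.T\<rbrakk> \<Longrightarrow> \<psi> (lact b t) = lact b (\<psi> t)"
    and r: "\<And>a t. \<lbrakk>a \<in> carrier A; t \<in> carrier BA.T\<rbrakk> \<Longrightarrow> \<psi> (ract t a) = ract (\<psi> t) a"
    using \<psi> by (simp_all add: tw_iff)
  have unit: "unit_tensor \<in> carrier BA.T" by simp
  note u = linear_map_closed[OF lin unit]
  show ?thesis
  proof (rule BA.linear_map_eqI[OF linear_map_comp[OF lin swap_linear]
        linear_map_comp[OF swap_linear AB.tensor_mult_linear(1)] _ t])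
    show "swap (\<psi> unit_tensor) \<in> carrier AB.T" by (rule swap_closed[OF u])
    fix b a assume b: "b \<in> carrier B" and a: "a \<in> carrier A"
    have "BA.pure b a = ract (lact b unit_tensor) a"
      using a b by (simp add: lact(2) ract(2))
    then have "swap (\<psi> (BA.pure b a)) = swap (ract (lact b (\<psi> unit_tensor)) a)"
      using a b unit by (simp add: l r linear_map_closed[OF lact(1)])
    also have "\<dots> = (swap (\<psi> unit_tensor) \<otimes>\<^bsub>C\<^esub> AB.pure \<one>\<^bsub>A\<^esub> b) \<otimes>\<^bsub>C\<^esub> AB.pure a \<one>\<^bsub>B\<^esub>"
      using a b u by (simp add: swap_lact swap_ract linear_map_closed[OF lact(1)])
    also have "\<dots> = swap (\<psi> unit_tensor) \<otimes>\<^bsub>C\<^esub> (AB.pure \<one>\<^bsub>A\<^esub> b \<otimes>\<^bsub>C\<^esub> AB.pure a \<one>\<^bsub>B\<^esub>)"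
      using a b u by (intro AB.tensor_mult_assoc swap_closed) simp_all
    also have "\<dots> = swap (\<psi> unit_tensor) \<otimes>\<^bsub>C\<^esub> swap (BA.pure b a)"
      using a b by (simp add: AB.pure_mult_pure swap_pure)
    finally show "swap (\<psi> (BA.pure b a)) = swap (\<psi> unit_tensor) \<otimes>\<^bsub>C\<^esub> swap (BA.pure b a)" .
  qed
qed

text \<open>Left multiplication by \<open>u\<close>, transported to \<open>B \<otimes> A\<close>. This inverts evaluation at the
  unit followed by the exchange of factors.\<close>

definition mult_twist where "mult_twist u = (\<lambda>t\<in>carrier BA.T. unswap (u \<otimes>\<^bsub>C\<^esub> swap t))"

text \<open>If \<open>f\<close> corresponds to right multiplication by some \<open>p\<close>, then it commutes with every left
  multiplication by associativity. Both actions are of this form.\<close>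

lemma mult_twist_commutes:
  assumes u: "u \<in> carrier AB.T" and p: "p \<in> carrier AB.T"
    and f: "\<And>t. t \<in> carrier BA.T \<Longrightarrow> f t \<in> carrier BA.T"
      "\<And>t. t \<in> carrier BA.T \<Longrightarrow> swap (f t) = swap t \<otimes>\<^bsub>C\<^esub> p"
    and t: "t \<in> carrier BA.T"
  shows "mult_twist u (f t) = f (mult_twist u t)"
proof -
  let ?s = "unswap (u \<otimes>\<^bsub>C\<^esub> swap t)"
  have closed: "u \<otimes>\<^bsub>C\<^esub> swap t \<in> carrier AB.T"
    using u t by (intro AB.tensor_mult_closed swap_closed)
  then have s: "?s \<in> carrier BA.T" "swap ?s = u \<otimes>\<^bsub>C\<^esub> swap t"
    by (simp_all add: unswap_closed swap_unswap)
  have "u \<otimes>\<^bsub>C\<^esub> swap (f t) = (u \<otimes>\<^bsub>C\<^esub> swap t) \<otimes>\<^bsub>C\<^esub> p"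
    unfolding f(2)[OF t] using u p t by (intro AB.tensor_mult_assoc[symmetric] swap_closed)
  also have "\<dots> = swap (f ?s)"
    by (simp add: f(2)[OF s(1)] s(2))
  finally have "unswap (u \<otimes>\<^bsub>C\<^esub> swap (f t)) = f ?s"
    by (simp add: unswap_swap[OF f(1)[OF s(1)]])
  then show ?thesis by (simp add: mult_twist_def t f(1))
qed

lemma mult_twist_closed:
  assumes u: "u \<in> carrier AB.T"
  shows "mult_twist u \<in> carrier (tw K A B)"
proof -
  have "linear_map K BA.T BA.T (mult_twist u)"
    by (rule linear_map_cong[OF BA.T.module_axioms linear_map_comp[OF
            linear_map_comp[OF swap_linear AB.tensor_mult_linear(1)[OF u]] unswap_linear]])
      (simp add: mult_twist_def)
  moreover have "mult_twist u (lact b t) = lact b (mult_twist u t)"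
    if "b \<in> carrier B" "t \<in> carrier BA.T" for b t
    by (rule mult_twist_commutes[OF u _ linear_map_closed[OF lact(1)] swap_lact])
      (simp_all add: that)
  moreover have "mult_twist u (ract t a) = ract (mult_twist u t) a"
    if "a \<in> carrier A" "t \<in> carrier BA.T" for a t
    by (rule mult_twist_commutes[where f = "\<lambda>t. ract t a",
          OF u _ linear_map_closed[OF ract(1)] swap_ract]) (simp_all add: that)
  ultimately show ?thesis by (simp add: tw_iff mult_twist_def)
qed

theorem eval_unit_iso: "(\<lambda>\<psi>. swap (\<psi> unit_tensor)) \<in> algebra_iso K (tw K A B) C"
proof -
  let ?G = "\<lambda>\<psi>. swap (\<psi> unit_tensor)"
  have unit: "unit_tensor \<in> carrier BA.T" by simp
  have "?G \<in> ring_hom (tw K A B) C"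
  proof (rule ring_hom_memI)
    fix \<psi> \<chi> assume \<psi>: "\<psi> \<in> carrier (tw K A B)" and \<chi>: "\<chi> \<in> carrier (tw K A B)"
    show "?G (\<psi> \<otimes>\<^bsub>tw K A B\<^esub> \<chi>) = ?G \<psi> \<otimes>\<^bsub>C\<^esub> ?G \<chi>"
      using swap_tw[OF \<psi> tw_closed[OF \<chi> unit]] unit by (simp add: tw_simps)
    show "?G (\<psi> \<oplus>\<^bsub>tw K A B\<^esub> \<chi>) = ?G \<psi> \<oplus>\<^bsub>C\<^esub> ?G \<chi>"
      using tw_closed[OF \<psi> unit] tw_closed[OF \<chi> unit] unit
      by (simp add: tw_simps linear_map_add[OF swap_linear])
  qed (use unit in \<open>simp_all add: tw_closed swap_closed tw_simps swap_unit\<close>)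
  moreover have "bij_betw ?G (carrier (tw K A B)) (carrier C)"
  proof (rule bij_betw_byWitness[where f' = mult_twist])
    show "\<forall>\<psi>\<in>carrier (tw K A B). mult_twist (?G \<psi>) = \<psi>"
    proof
      fix \<psi> assume \<psi>: "\<psi> \<in> carrier (tw K A B)"
      show "mult_twist (?G \<psi>) = \<psi>"
      proof (rule extensionalityI[of _ "carrier BA.T"])
        show "\<psi> \<in> extensional (carrier BA.T)" using \<psi> by (simp add: tw_iff)
        fix t assume t: "t \<in> carrier BA.T"
        then show "mult_twist (?G \<psi>) t = \<psi> t"
          using \<psi> by (simp add: mult_twist_def swap_tw[symmetric] unswap_swap tw_closed)
      qed (simp add: mult_twist_def)
    qed
    show "\<forall>u\<in>carrier C. ?G (mult_twist u) = u"
      using unit C.r_one by (simp add: mult_twist_def swap_unit swap_unswap)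
    show "?G ` carrier (tw K A B) \<subseteq> carrier C"
      by (simp add: image_subset_iff tw_closed swap_closed)
    show "mult_twist ` carrier C \<subseteq> carrier (tw K A B)"
      using mult_twist_closed by (simp add: image_subset_iff)
  qed
  moreover have "?G (c \<odot>\<^bsub>tw K A B\<^esub> \<psi>) = c \<odot>\<^bsub>C\<^esub> ?G \<psi>"
    if "c \<in> carrier K" "\<psi> \<in> carrier (tw K A B)" for c \<psi>
    using that tw_closed[OF that(2) unit] unit
    by (simp add: tw_simps linear_map_smult[OF swap_linear])
  ultimately show ?thesis by (simp add: algebra_iso_def ring_iso_def)
qed

end

theorem theorem6p17:
  fixes K :: "('k, 'r) ring_scheme"
    and A :: "('k, 'a, 'm) module_scheme"
    and B :: "('k, 'b, 'n) module_scheme"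
  assumes "field K"
    and "unital_algebra K A"
    and "unital_algebra K B"
  shows "unital_algebra K (tw K A B)
    \<and> unital_algebra K (tensor_algebra K A (opposite B))
    \<and> (\<exists>G. G \<in> algebra_iso K (tw K A B) (tensor_algebra K A (opposite B)))"
proof -
  interpret algebra_twists K A B
    by (rule algebra_twists.intro[OF assms(2,3)])
  show ?thesis
    using tw_unital_algebra AB.tensor_algebra_unital_algebra eval_unit_iso by blast
qed

end
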